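(* Let $U$ be a unital complex associative algebra with multiplication map $m:U\otimes U\to U$, $\theta\in\mathrm{Aut}(U)$ an involutive unital algebra automorphism with $(\pm1)$-eigenspaces $U^{\pm}$ (so $U^+$ is a unital subalgebra), and $\mathfrak{a}\subseteq U^-$ a finite dimensional linear subspace. Let $r:\mathfrak{a}^*\to U^{\otimes 2}$ be a meromorphic function which is $\theta$-twisted symmetric ($\widetilde r:=(\theta\otimes\mathrm{id})r$ satisfies $\widetilde r_{21}=\widetilde r$), $\mathfrak{a}$-invariant ($[x\otimes1+1\otimes x,r]=0$ for all $x\in\mathfrak{a}$) and a classical dynamical $r$-matrix ($\mathrm{YB}(r)=0$). Write $r^{\pm}:=\frac12(\widetilde r\pm r):\mathfrak{a}^*\to U^{\pm}\otimes U$ and $\kappa^{\mathrm{core}}:=\frac12m(\widetilde r):\mathfrak{a}^*\to U$. Label the tensor components of $U^+\otimes U\otimes U^+$ by $0,1,0'$. Then for $\kappa:\mathfrak{a}^*\to U^+\otimes U\otimes U^+$ equal to any one of the three meromorphic functions $$\kappa^{\mathrm{core}}_1+r^+_{01},\qquad \kappa^{\mathrm{core}}_1+r^+_{0'1},\qquad \kappa^{\mathrm{core}}_1+r^+_{01}+r^+_{0'1},$$ $\kappa$ is a classical dynamical $k$-matrix relative to $(r^+,r^-)$, i.e. $\mathrm{CR}(r^+,r^-;\kappa)=0$ in $U^+\otimes U^{\otimes 2}\otimes U^+$.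
   Context: All tensor products are over $\mathbb{C}$. $\mathcal{M}$ is the field of meromorphic functions on $\mathfrak{a}^*$; for a complex algebra $B$, a meromorphic function $\mathfrak{a}^*\to B$ means an element of $\mathcal{M}\otimes B$ (algebraic tensor product; linear maps are applied pointwise). Subscripts indicate placement: $z_{i_1\cdots i_k}$ has the $j$-th tensor component of $z$ in the tensor position labelled $i_j$ and $1$ in all other positions. E.g. $r^+_{0'1}$ has the first component of $r^+$ (in $U^+$) in position $0'$ and the second in position $1$. Let $\{x_k\}_{k=1}^d$ be a basis of $\mathfrak{a}$ with dual basis $\{\lambda_k\}$ of $\mathfrak{a}^*$, $\partial_\lambda$ the directional derivative, and $E_i(f):=\sum_k (x_k)_i\,\partial_{\lambda_k}(f)$. Definitions: $$\mathrm{YB}(r):=[r_{12},r_{13}]+[r_{12},r_{23}]+[r_{13},r_{23}]+E_1(r_{23})-E_2(r_{13})+E_3(r_{12})\quad\text{in }U^{\otimes3}.$$ For unital algebras $A_\ell,A_r$ and meromorphic $r^{\pm}:\mathfrak{a}^*\to U^{\otimes2}$, $\kappa:\mathfrak{a}^*\to A_\ell\otimes U\otimes A_r$, $$\mathrm{CR}(r^+,r^-;\kappa):=[\kappa_1+r^-,\kappa_2+r^+]+E_2(r^-+\kappa_1)-E_1(r^++\kappa_2)\quad\text{in }A_\ell\otimes U^{\otimes2}\otimes A_r,$$ where the tensor positions of $A_\ell\otimes U^{\otimes 2}\otimes A_r$ are labelled $0,1,2,0'$, $r^{\pm}$ stands for $r^{\pm}_{12}$, and $\kappa_i$ ($i=1,2$)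 is $\kappa$ with its $A_\ell$- and $A_r$-components in positions $0$, $0'$ and its $U$-component in position $i$. Here $A_\ell=A_r=U^+$. *)

theory Defs
  imports "HOL-Complex_Analysis.Complex_Analysis" "HOL-Library.Poly_Mapping"
begin

section \<open>Complex vector spaces and complex algebras\<close>

class complex_vector = ab_group_add +
  fixes scaleC :: "complex \<Rightarrow> 'a \<Rightarrow> 'a"  (infixr \<open>*\<^sub>C\<close> 75)
  assumes scaleC_add_right: "c *\<^sub>C (x + y) = c *\<^sub>C x + c *\<^sub>C y"
    and scaleC_add_left: "(c + d) *\<^sub>C x = c *\<^sub>C x + d *\<^sub>C x"
    and scaleC_scaleC: "c *\<^sub>C (d *\<^sub>C x) = (c * d) *\<^sub>C x"
    and scaleC_one: "1 *\<^sub>C x = x"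

text \<open>Unlike \<open>ring_1\<close>, this admits the zero algebra.\<close>

class complex_algebra_1 = complex_vector + ring + monoid_mult +
  assumes mult_scaleC_left: "(c *\<^sub>C x) * y = c *\<^sub>C (x * y)"
    and mult_scaleC_right: "x * (c *\<^sub>C y) = c *\<^sub>C (x * y)"

abbreviation clinear :: "('a::complex_vector \<Rightarrow> 'b::complex_vector) \<Rightarrow> bool"
  where "clinear \<equiv> Vector_Spaces.linear scaleC scaleC"

abbreviation cspan :: "'a::complex_vector set \<Rightarrow> 'a set"
  where "cspan \<equiv> module.span scaleC"

abbreviation csubspace :: "'a::complex_vector set \<Rightarrow> bool"
  where "csubspace \<equiv> module.subspace scaleC"

abbreviation cindependent :: "'a::complex_vector set \<Rightarrow> bool"
  where "cindependent S \<equiv> \<not> module.dependent scaleC S"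

lemma vector_space_scaleC: "vector_space (scaleC :: complex \<Rightarrow> 'a \<Rightarrow> 'a::complex_vector)"
  by unfold_locales (simp_all add: scaleC_add_right scaleC_add_left scaleC_scaleC scaleC_one)

interpretation cv: vector_space "scaleC :: complex \<Rightarrow> 'a \<Rightarrow> 'a::complex_vector"
  by (rule vector_space_scaleC)

lemma clinear_iff:
  "clinear f \<longleftrightarrow> (\<forall>x y. f (x + y) = f x + f y) \<and> (\<forall>c x. f (c *\<^sub>C x) = c *\<^sub>C f x)"
  by (auto simp: Vector_Spaces.linear_def module_hom_def module_hom_axioms_def
      vector_space_scaleC cv.module_axioms)

lemma clinearI:
  assumes "\<And>x y. f (x + y) = f x + f y" "\<And>c x. f (c *\<^sub>C x) = c *\<^sub>C f x"
  shows "clinear f"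
  using assms by (simp add: clinear_iff)

lemma clinear_add: "clinear f \<Longrightarrow> f (x + y) = f x + f y"
  and clinear_scaleC: "clinear f \<Longrightarrow> f (c *\<^sub>C x) = c *\<^sub>C f x"
  by (simp_all add: clinear_iff)

lemma clinear_0: "clinear f \<Longrightarrow> f 0 = 0"
  by (metis clinear_add add_cancel_left_left)

lemma clinear_minus: "clinear f \<Longrightarrow> f (- x) = - f x"
  by (metis clinear_0 clinear_add eq_neg_iff_add_eq_0)

lemma clinear_diff: "clinear f \<Longrightarrow> f (x - y) = f x - f y"
  by (metis clinear_add clinear_minus uminus_add_conv_diff add.commute)

lemma clinear_sum: "clinear f \<Longrightarrow> f (sum g A) = (\<Sum>x\<in>A. f (g x))"
  by (induction A rule: infinite_finite_induct) (simp_all add: clinear_0 clinear_add)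

lemma clinear_id: "clinear (\<lambda>x. x)"
  by (simp add: clinear_iff)

lemma clinear_compose: "clinear f \<Longrightarrow> clinear g \<Longrightarrow> clinear (\<lambda>x. f (g x))"
  by (simp add: clinear_iff)

instantiation complex :: complex_algebra_1
begin
definition scaleC_complex :: "complex \<Rightarrow> complex \<Rightarrow> complex"
  where "scaleC_complex c x = c * x"
instance by standard (simp_all add: scaleC_complex_def algebra_simps)
end

definition commutator :: "'a::complex_algebra_1 \<Rightarrow> 'a \<Rightarrow> 'a"
  where "commutator a b = a * b - b * a"

definition eigenspace :: "('a::complex_vector \<Rightarrow> 'a) \<Rightarrow> complex \<Rightarrow> 'a set"
  where "eigenspace f c = {u. f u = c *\<^sub>C u}"

definition unital_algebra_hom :: "('a::complex_algebra_1 \<Rightarrow> 'b::complex_algebra_1) \<Rightarrow> bool"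
  where "unital_algebra_hom f \<longleftrightarrow> clinear f \<and> (\<forall>x y. f (x * y) = f x * f y) \<and> f 1 = 1"

definition unital_subalgebra :: "'a::complex_algebra_1 set \<Rightarrow> bool"
  where "unital_subalgebra A \<longleftrightarrow> csubspace A \<and> 1 \<in> A \<and> (\<forall>x\<in>A. \<forall>y\<in>A. x * y \<in> A)"


section \<open>The algebraic tensor product over the complex numbers\<close>

instantiation poly_mapping :: (type, complex_vector) complex_vector
begin

lift_definition scaleC_poly_mapping :: "complex \<Rightarrow> ('a \<Rightarrow>\<^sub>0 'b) \<Rightarrow> ('a \<Rightarrow>\<^sub>0 'b)"
  is "\<lambda>c p k. c *\<^sub>C p k"
  by (rule finite_subset[rotated]) auto

instance
  by standard (transfer; simp add: fun_eq_iff scaleC_add_right scaleC_add_left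
      scaleC_scaleC scaleC_one)+

end

lemma lookup_scaleC: "Poly_Mapping.lookup (c *\<^sub>C p) k = c *\<^sub>C Poly_Mapping.lookup p k"
  by transfer simp

text \<open>The free complex vector space on \<open>'a \<times> 'b\<close> is \<open>('a \<times> 'b) \<Rightarrow>\<^sub>0 complex\<close>.\<close>

abbreviation free_pair :: "'a \<Rightarrow> 'b \<Rightarrow> ('a \<times> 'b) \<Rightarrow>\<^sub>0 complex"
  where "free_pair a b \<equiv> Poly_Mapping.single (a, b) 1"

definition tensor_relators ::
    "(('a::complex_vector \<times> 'b::complex_vector) \<Rightarrow>\<^sub>0 complex) set"
  where "tensor_relators =
      {free_pair (a + a') b - (free_pair a b + free_pair a' b) | a a' b. True} \<union>
      {free_pair a (b + b') - (free_pair a b + free_pair a b') | a b b'. True} \<union>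
      {free_pair (c *\<^sub>C a) b - c *\<^sub>C free_pair a b | c a b. True} \<union>
      {free_pair a (c *\<^sub>C b) - c *\<^sub>C free_pair a b | c a b. True}"

quotient_type (overloaded) ('a, 'b) tensor (infixr \<open>\<otimes>\<close> 70) =
  "('a::complex_vector \<times> 'b::complex_vector) \<Rightarrow>\<^sub>0 complex" /
  "\<lambda>p q. p - q \<in> cspan tensor_relators"
proof (rule equivpI)
  show "reflp (\<lambda>p q. p - q \<in> cspan (tensor_relators :: (('a \<times> 'b) \<Rightarrow>\<^sub>0 complex) set))"
    by (simp add: reflp_def cv.span_zero)
  show "symp (\<lambda>p q. p - q \<in> cspan (tensor_relators :: (('a \<times> 'b) \<Rightarrow>\<^sub>0 complex) set))"
    by (auto simp: symp_def) (metis cv.span_neg minus_diff_eq)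
  show "transp (\<lambda>p q. p - q \<in> cspan (tensor_relators :: (('a \<times> 'b) \<Rightarrow>\<^sub>0 complex) set))"
    unfolding transp_def by (auto dest: cv.span_add)
qed

lift_definition pure_tensor :: "'a::complex_vector \<Rightarrow> 'b::complex_vector \<Rightarrow> 'a \<otimes> 'b"
    (infixr \<open>\<otimes>\<close> 72)
  is "\<lambda>a b. free_pair a b" .

instantiation tensor :: (complex_vector, complex_vector) complex_vector
begin

lift_definition zero_tensor :: "'a \<otimes> 'b" is 0 .

lift_definition plus_tensor :: "'a \<otimes> 'b \<Rightarrow> 'a \<otimes> 'b \<Rightarrow> 'a \<otimes> 'b" is "(+)"
  subgoal for p p' q q'
    using cv.span_add[of "p - p'" tensor_relators "q - q'"] by (simp add: algebra_simps)
  done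

lift_definition minus_tensor :: "'a \<otimes> 'b \<Rightarrow> 'a \<otimes> 'b \<Rightarrow> 'a \<otimes> 'b" is "(-)"
  subgoal for p p' q q'
    using cv.span_diff[of "p - p'" tensor_relators "q - q'"] by (simp add: algebra_simps)
  done

lift_definition uminus_tensor :: "'a \<otimes> 'b \<Rightarrow> 'a \<otimes> 'b" is uminus
  subgoal for p p'
    using cv.span_neg[of "p - p'" tensor_relators] by simp
  done

lift_definition scaleC_tensor :: "complex \<Rightarrow> 'a \<otimes> 'b \<Rightarrow> 'a \<otimes> 'b" is scaleC
  subgoal for c p p'
    using cv.span_scale[of "p - p'" tensor_relators c] by (simp add: cv.scale_right_diff_distrib)
  done

instance
  by standard (transfer; simp add: algebra_simps cv.span_zero scaleC_add_right scaleC_add_left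
      scaleC_scaleC scaleC_one)+

end

lemma tensor_add_left: "(a + a') \<otimes> b = a \<otimes> b + a' \<otimes> b"
  by transfer (rule cv.span_base, unfold tensor_relators_def, blast)

lemma tensor_add_right: "a \<otimes> (b + b') = a \<otimes> b + a \<otimes> b'"
  by transfer (rule cv.span_base, unfold tensor_relators_def, blast)

lemma tensor_scaleC_left: "(c *\<^sub>C a) \<otimes> b = c *\<^sub>C (a \<otimes> b)"
  by transfer (rule cv.span_base, unfold tensor_relators_def, blast)

lemma tensor_scaleC_right: "a \<otimes> (c *\<^sub>C b) = c *\<^sub>C (a \<otimes> b)"
  by transfer (rule cv.span_base, unfold tensor_relators_def, blast)

lemma poly_mapping_single_induct:
  fixes p :: "'k \<Rightarrow>\<^sub>0 'b::comm_monoid_add"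
  assumes "P 0" "\<And>k c p. P p \<Longrightarrow> P (Poly_Mapping.single k c + p)"
  shows "P p"
proof -
  have "P q" if "finite K" "Poly_Mapping.keys q \<subseteq> K" for K and q :: "'k \<Rightarrow>\<^sub>0 'b"
    using that
  proof (induction K arbitrary: q rule: finite_induct)
    case empty
    then have "q = 0"
      by (auto intro!: poly_mapping_eqI simp: in_keys_iff)
    then show ?case using assms(1) by simp
  next
    case (insert k K)
    define q' where "q' = Poly_Mapping.update k 0 q"
    have "Poly_Mapping.keys q' \<subseteq> K"
      using insert.prems by (auto simp: q'_def in_keys_iff lookup_update split: if_splits)
    then have "P q'" by (rule insert.IH)
    moreover have "q = Poly_Mapping.single k (Poly_Mapping.lookup q k) + q'"
      by (rule poly_mapping_eqI) (auto simp: q'_def lookup_add lookup_single lookup_update when_def)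
    ultimately show ?case using assms(2) by metis
  qed
  then show ?thesis by (meson finite_keys order_refl)
qed

lemma tensor_induct [case_names pure add]:
  assumes "\<And>a b. P (a \<otimes> b)" "\<And>s t. P s \<Longrightarrow> P t \<Longrightarrow> P (s + t)"
  shows "P t"
proof -
  have "P (abs_tensor p)" for p
  proof (induction p rule: poly_mapping_single_induct)
    case 1
    have "(0::'a \<otimes> 'b) = 0 *\<^sub>C (0 \<otimes> 0)" by simp
    also have "\<dots> = 0 \<otimes> 0" by (metis tensor_scaleC_left cv.scale_zero_right)
    finally show ?case using assms(1) by (metis zero_tensor.abs_eq)
  next
    case (2 k c p)
    obtain a b where k: "k = (a, b)" by fastforce
    have "Poly_Mapping.single k c = c *\<^sub>C free_pair a b"
      by (rule poly_mapping_eqI) (auto simp: k lookup_scaleC lookup_single when_def scaleC_complex_def)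
    then have "abs_tensor (Poly_Mapping.single k c + p) = (c *\<^sub>C a) \<otimes> b + abs_tensor p"
      by (simp add: plus_tensor.abs_eq[symmetric] scaleC_tensor.abs_eq[symmetric]
          pure_tensor.abs_eq[symmetric] tensor_scaleC_left)
    then show ?case using assms 2 by simp
  qed
  from this[of "rep_tensor t"] show ?thesis by (simp add: Quotient3_abs_rep[OF Quotient3_tensor])
qed

definition cbilinear ::
    "('a::complex_vector \<Rightarrow> 'b::complex_vector \<Rightarrow> 'c::complex_vector) \<Rightarrow> bool"
  where "cbilinear \<beta> \<longleftrightarrow> (\<forall>b. clinear (\<lambda>a. \<beta> a b)) \<and> (\<forall>a. clinear (\<beta> a))"

text \<open>The linear map induced by a bilinear map \<open>\<beta>\<close>, evaluated on a chosen representative;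
  \<open>tensor_lift_pure\<close> and \<open>clinear_tensor_lift\<close> below are the universal property.\<close>

definition free_lift ::
    "('a \<Rightarrow> 'b \<Rightarrow> 'c::complex_vector) \<Rightarrow> (('a \<times> 'b) \<Rightarrow>\<^sub>0 complex) \<Rightarrow> 'c"
  where "free_lift \<beta> p = (\<Sum>k\<in>Poly_Mapping.keys p. Poly_Mapping.lookup p k *\<^sub>C \<beta> (fst k) (snd k))"

definition tensor_lift ::
    "('a::complex_vector \<Rightarrow> 'b::complex_vector \<Rightarrow> 'c::complex_vector) \<Rightarrow> 'a \<otimes> 'b \<Rightarrow> 'c"
  where "tensor_lift \<beta> t = free_lift \<beta> (rep_tensor t)"

lemma free_lift_superset:
  assumes "finite K" "Poly_Mapping.keys p \<subseteq> K"
  shows "free_lift \<beta> p = (\<Sum>k\<in>K. Poly_Mapping.lookup p k *\<^sub>C \<beta> (fst k) (snd k))"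
  unfolding free_lift_def
  by (rule sum.mono_neutral_left) (use assms in \<open>auto simp: in_keys_iff\<close>)

lemma clinear_free_lift: "clinear (free_lift \<beta>)"
proof (rule clinearI)
  fix p q :: "('a \<times> 'b) \<Rightarrow>\<^sub>0 complex"
  let ?K = "Poly_Mapping.keys p \<union> Poly_Mapping.keys q"
  have "free_lift \<beta> (p + q) = (\<Sum>k\<in>?K. Poly_Mapping.lookup (p + q) k *\<^sub>C \<beta> (fst k) (snd k))"
    by (rule free_lift_superset) (use Poly_Mapping.keys_add[of p q] in auto)
  also have "\<dots> = free_lift \<beta> p + free_lift \<beta> q"
    by (simp add: lookup_add scaleC_add_left sum.distrib free_lift_superset[of ?K p]
        free_lift_superset[of ?K q])
  finally show "free_lift \<beta> (p + q) = free_lift \<beta> p + free_lift \<beta> q" .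
next
  fix c and p :: "('a \<times> 'b) \<Rightarrow>\<^sub>0 complex"
  have "free_lift \<beta> (c *\<^sub>C p)
      = (\<Sum>k\<in>Poly_Mapping.keys p. Poly_Mapping.lookup (c *\<^sub>C p) k *\<^sub>C \<beta> (fst k) (snd k))"
    by (rule free_lift_superset) (auto simp: in_keys_iff lookup_scaleC)
  also have "\<dots> = c *\<^sub>C free_lift \<beta> p"
    by (simp add: lookup_scaleC free_lift_def cv.scale_sum_right scaleC_scaleC scaleC_complex_def)
  finally show "free_lift \<beta> (c *\<^sub>C p) = c *\<^sub>C free_lift \<beta> p" .
qed

lemma free_lift_pair: "free_lift \<beta> (free_pair a b) = \<beta> a b"
  by (simp add: free_lift_def scaleC_one)

lemma free_lift_relator:
  assumes \<beta>: "cbilinear \<beta>" and p: "p \<in> cspan tensor_relators"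
  shows "free_lift \<beta> p = 0"
  using p
proof (induction rule: cv.span_induct_alt)
  case base
  show ?case by (simp add: clinear_0[OF clinear_free_lift])
next
  case (step c x y)
  have bil: "\<beta> (a + a') b = \<beta> a b + \<beta> a' b" "\<beta> a (b + b') = \<beta> a b + \<beta> a b'"
    "\<beta> (c *\<^sub>C a) b = c *\<^sub>C \<beta> a b" "\<beta> a (c *\<^sub>C b) = c *\<^sub>C \<beta> a b" for a a' b b' c
    using \<beta> by (simp_all add: cbilinear_def clinear_iff)
  have "free_lift \<beta> x = 0"
    using step.hyps(1)
    by (auto simp: tensor_relators_def bil free_lift_pair clinear_diff[OF clinear_free_lift] clinear_add[OF clinear_free_lift]
        clinear_scaleC[OF clinear_free_lift])
  then show ?case
    using step.IH by (simp add: clinear_add[OF clinear_free_lift] clinear_scaleC[OF clinear_free_lift])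
qed

lemma tensor_lift_abs:
  assumes "cbilinear \<beta>"
  shows "tensor_lift \<beta> (abs_tensor p) = free_lift \<beta> p"
proof -
  have "rep_tensor (abs_tensor p) - p \<in> cspan tensor_relators"
    by (rule Quotient3_rep_abs[OF Quotient3_tensor]) (simp add: cv.span_zero)
  then have "free_lift \<beta> (rep_tensor (abs_tensor p) - p) = 0"
    by (rule free_lift_relator[OF assms])
  then show ?thesis
    by (simp add: tensor_lift_def clinear_diff[OF clinear_free_lift])
qed

lemma tensor_lift_pure: "cbilinear \<beta> \<Longrightarrow> tensor_lift \<beta> (a \<otimes> b) = \<beta> a b"
  by (simp add: pure_tensor.abs_eq tensor_lift_abs free_lift_pair)

lemma clinear_tensor_lift:
  assumes "cbilinear \<beta>"
  shows "clinear (tensor_lift \<beta>)"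
proof (rule clinearI)
  fix s t :: "'a \<otimes> 'b" and c
  have s: "s = abs_tensor (rep_tensor s)" and t: "t = abs_tensor (rep_tensor t)"
    by (simp_all add: Quotient3_abs_rep[OF Quotient3_tensor])
  show "tensor_lift \<beta> (s + t) = tensor_lift \<beta> s + tensor_lift \<beta> t"
    by (subst (1 2) s, subst (1 2) t)
      (simp only: plus_tensor.abs_eq tensor_lift_abs[OF assms] clinear_add[OF clinear_free_lift])
  show "tensor_lift \<beta> (c *\<^sub>C t) = c *\<^sub>C tensor_lift \<beta> t"
    by (subst (1 2) t)
      (simp only: scaleC_tensor.abs_eq tensor_lift_abs[OF assms] clinear_scaleC[OF clinear_free_lift])
qed

lemma tensor_eq_clinear:
  assumes "clinear f" "clinear g" "\<And>a b. f (a \<otimes> b) = g (a \<otimes> b)"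
  shows "f t = g t"
  by (induction t rule: tensor_induct) (use assms in \<open>simp_all add: clinear_add\<close>)

definition tensor_map ::
    "('a::complex_vector \<Rightarrow> 'c::complex_vector) \<Rightarrow> ('b::complex_vector \<Rightarrow> 'd::complex_vector)
      \<Rightarrow> 'a \<otimes> 'b \<Rightarrow> 'c \<otimes> 'd"
  where "tensor_map f g = tensor_lift (\<lambda>a b. f a \<otimes> g b)"

definition tensor_flip :: "'a::complex_vector \<otimes> 'b::complex_vector \<Rightarrow> 'b \<otimes> 'a"
  where "tensor_flip = tensor_lift (\<lambda>a b. b \<otimes> a)"

lemma cbilinearI:
  assumes "\<And>a a' b. \<beta> (a + a') b = \<beta> a b + \<beta> a' b" "\<And>a b b'. \<beta> a (b + b') = \<beta> a b + \<beta> a b'"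
    and "\<And>c a b. \<beta> (c *\<^sub>C a) b = c *\<^sub>C \<beta> a b" "\<And>c a b. \<beta> a (c *\<^sub>C b) = c *\<^sub>C \<beta> a b"
  shows "cbilinear \<beta>"
  using assms by (simp add: cbilinear_def clinear_iff)

lemmas tensor_bilinear_simps =
  tensor_add_left tensor_add_right tensor_scaleC_left tensor_scaleC_right

lemma cbilinear_tensor_map:
  assumes "clinear f" "clinear g"
  shows "cbilinear (\<lambda>a b. f a \<otimes> g b)"
  by (rule cbilinearI)
    (simp_all add: clinear_add[OF assms(1)] clinear_add[OF assms(2)] clinear_scaleC[OF assms(1)]
      clinear_scaleC[OF assms(2)] tensor_bilinear_simps)

lemma tensor_map_pure: "clinear f \<Longrightarrow> clinear g \<Longrightarrow> tensor_map f g (a \<otimes> b) = f a \<otimes> g b"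
  and clinear_tensor_map: "clinear f \<Longrightarrow> clinear g \<Longrightarrow> clinear (tensor_map f g)"
  unfolding tensor_map_def
  by (rule tensor_lift_pure[OF cbilinear_tensor_map] clinear_tensor_lift[OF cbilinear_tensor_map];
      assumption)+

lemma cbilinear_tensor_flip: "cbilinear (\<lambda>a b. b \<otimes> a)"
  by (rule cbilinearI) (simp_all add: tensor_bilinear_simps)

lemma tensor_flip_pure: "tensor_flip (a \<otimes> b) = b \<otimes> a"
  and clinear_tensor_flip: "clinear tensor_flip"
  unfolding tensor_flip_def
  by (rule tensor_lift_pure[OF cbilinear_tensor_flip] clinear_tensor_lift[OF cbilinear_tensor_flip])+

lemma clinear_tensor_left: "clinear (\<lambda>a. a \<otimes> b)"
  and clinear_tensor_right: "clinear (\<lambda>b. a \<otimes> b)"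
  by (simp_all add: clinear_iff tensor_add_left tensor_add_right
      tensor_scaleC_left tensor_scaleC_right)

text \<open>The image of \<open>A \<otimes> B\<close> in \<open>'a \<otimes> 'b\<close> for linear subspaces \<open>A\<close>, \<open>B\<close>; over a field this is a
  copy of the tensor product of \<open>A\<close> and \<open>B\<close>.\<close>

definition tensor_subspace ::
    "'a::complex_vector set \<Rightarrow> 'b::complex_vector set \<Rightarrow> ('a \<otimes> 'b) set"
  where "tensor_subspace A B = cspan {a \<otimes> b | a b. a \<in> A \<and> b \<in> B}"

lemma clinear_times_left: "clinear ((*) (x::'x::complex_algebra_1))"
  and clinear_times_right: "clinear (\<lambda>y::'x. y * x)"
  by (simp_all add: clinear_iff distrib_left distrib_right mult_scaleC_right mult_scaleC_left)

lemma cbilinear_tensor_times: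
  "cbilinear (\<lambda>(a::'a::complex_algebra_1) (b::'b::complex_algebra_1). tensor_map ((*) a) ((*) b) t)"
proof (rule cbilinearI)
  note map_pure = tensor_map_pure[OF clinear_times_left clinear_times_left]
  note map_add = clinear_add[OF clinear_tensor_map[OF clinear_times_left clinear_times_left]]
  fix a a' :: 'a and b b' :: 'b and c
  show "tensor_map ((*) (a + a')) ((*) b) t
      = tensor_map ((*) a) ((*) b) t + tensor_map ((*) a') ((*) b) t"
  proof (induction t rule: tensor_induct)
    case pure
    show ?case unfolding map_pure by (simp add: distrib_right tensor_bilinear_simps)
  next
    case add
    then show ?case unfolding map_add by (simp only: add_ac)
  qed
  show "tensor_map ((*) a) ((*) (b + b')) t
      = tensor_map ((*) a) ((*) b) t + tensor_map ((*) a) ((*) b') t"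
  proof (induction t rule: tensor_induct)
    case pure
    show ?case unfolding map_pure by (simp add: distrib_right tensor_bilinear_simps)
  next
    case add
    then show ?case unfolding map_add by (simp only: add_ac)
  qed
  show "tensor_map ((*) (c *\<^sub>C a)) ((*) b) t = c *\<^sub>C tensor_map ((*) a) ((*) b) t"
  proof (induction t rule: tensor_induct)
    case pure
    show ?case unfolding map_pure by (simp add: mult_scaleC_left tensor_bilinear_simps)
  next
    case add
    then show ?case unfolding map_add by (simp only: scaleC_add_right)
  qed
  show "tensor_map ((*) a) ((*) (c *\<^sub>C b)) t = c *\<^sub>C tensor_map ((*) a) ((*) b) t"
  proof (induction t rule: tensor_induct)
    case pure
    show ?case unfolding map_pure by (simp add: mult_scaleC_left tensor_bilinear_simps)
  next
    case add
    then show ?case unfolding map_add by (simp only: scaleC_add_right)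
  qed
qed

instantiation tensor :: (complex_algebra_1, complex_algebra_1) complex_algebra_1
begin

definition one_tensor :: "'a \<otimes> 'b" where "one_tensor = 1 \<otimes> 1"

definition times_tensor :: "'a \<otimes> 'b \<Rightarrow> 'a \<otimes> 'b \<Rightarrow> 'a \<otimes> 'b"
  where "s * t = tensor_lift (\<lambda>a b. tensor_map ((*) a) ((*) b) t) s"

lemma tensor_times_pure_left: "(a \<otimes> b) * t = tensor_map ((*) a) ((*) b) t"
  for a :: 'a and b :: 'b
  by (simp add: times_tensor_def tensor_lift_pure[OF cbilinear_tensor_times])

lemma tensor_times_pure: "(a \<otimes> b) * (a' \<otimes> b') = (a * a') \<otimes> (b * b')"
  for a a' :: 'a and b b' :: 'b
  by (simp add: tensor_times_pure_left tensor_map_pure[OF clinear_times_left clinear_times_left])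

lemma clinear_tensor_times_right: "clinear (\<lambda>s. s * t)"
  for t :: "'a \<otimes> 'b"
  unfolding times_tensor_def by (rule clinear_tensor_lift[OF cbilinear_tensor_times])

lemma clinear_tensor_times_left: "clinear ((*) s)"
  for s :: "'a \<otimes> 'b"
proof (rule clinearI)
  note lin = clinear_tensor_map[OF clinear_times_left clinear_times_left]
  fix t t' :: "'a \<otimes> 'b" and c
  show "s * (t + t') = s * t + s * t'"
    by (induction s rule: tensor_induct)
      (simp_all add: tensor_times_pure_left clinear_add[OF lin]
        clinear_add[OF clinear_tensor_times_right] add_ac)
  show "s * (c *\<^sub>C t) = c *\<^sub>C (s * t)"
    by (induction s rule: tensor_induct)
      (simp_all add: tensor_times_pure_left clinear_scaleC[OF lin]
        clinear_add[OF clinear_tensor_times_right] scaleC_add_right)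
qed

instance
proof
  note dist = clinear_add[OF clinear_tensor_times_right] clinear_add[OF clinear_tensor_times_left]
  fix x y z :: "'a \<otimes> 'b" and c
  show "(x + y) * z = x * z + y * z" "x * (y + z) = x * y + x * z"
    by (rule dist)+
  show "(c *\<^sub>C x) * y = c *\<^sub>C (x * y)" "x * (c *\<^sub>C y) = c *\<^sub>C (x * y)"
    by (rule clinear_scaleC[OF clinear_tensor_times_right]
        clinear_scaleC[OF clinear_tensor_times_left])+
  show "1 * x = x"
    by (induction x rule: tensor_induct) (simp_all add: one_tensor_def tensor_times_pure dist)
  show "x * 1 = x"
    by (induction x rule: tensor_induct) (simp_all add: one_tensor_def tensor_times_pure dist)
  have pure3: "(a \<otimes> b) * (a' \<otimes> b') * z = (a \<otimes> b) * ((a' \<otimes> b') * z)" for a a' :: 'a and b b' :: 'b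
    by (induction z rule: tensor_induct) (simp_all add: tensor_times_pure mult.assoc dist)
  have "(a \<otimes> b) * y * z = (a \<otimes> b) * (y * z)" for a :: 'a and b :: 'b
    by (induction y rule: tensor_induct) (simp_all add: pure3 dist)
  then show "x * y * z = x * (y * z)"
    by (induction x rule: tensor_induct) (simp_all add: dist)
qed

end

section \<open>Meromorphic functions\<close>

class complex_tvs = complex_vector + topological_space +
  assumes tendsto_plus_pair:
      "filterlim (\<lambda>z. fst z + snd z) (nhds (x + y)) (nhds x \<times>\<^sub>F nhds y)"
    and tendsto_scaleC_pair:
      "filterlim (\<lambda>z. fst z *\<^sub>C snd z) (nhds (c *\<^sub>C x)) (nhds c \<times>\<^sub>F nhds x)"

lemma continuous_on_plus_tvs:
  fixes f g :: "'x::topological_space \<Rightarrow> 'v::complex_tvs"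
  assumes "continuous_on S f" "continuous_on S g"
  shows "continuous_on S (\<lambda>x. f x + g x)"
  using assms unfolding continuous_on_def
  by (auto intro: filterlim_compose[OF tendsto_plus_pair filterlim_Pair, unfolded fst_conv snd_conv])

lemma continuous_on_scaleC_tvs:
  fixes g :: "'x::topological_space \<Rightarrow> 'v::complex_tvs"
  assumes "continuous_on S f" "continuous_on S g"
  shows "continuous_on S (\<lambda>x. f x *\<^sub>C g x)"
  using assms unfolding continuous_on_def
  by (auto intro: filterlim_compose[OF tendsto_scaleC_pair filterlim_Pair, unfolded fst_conv snd_conv])

lemmas continuous_intros_tvs = continuous_on_plus_tvs continuous_on_scaleC_tvs continuous_intros

text \<open>Several complex variables, without coordinates: \<open>f\<close> is continuous and holomorphic along
  every complex line. On a finite dimensional space this is the usual notion of a holomorphic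
  function (Osgood's lemma).\<close>

definition tvs_holomorphic_on :: "('v::complex_tvs \<Rightarrow> complex) \<Rightarrow> 'v set \<Rightarrow> bool"
    (infixl \<open>tvs'_holomorphic'_on\<close> 50)
  where "f tvs_holomorphic_on N \<longleftrightarrow> continuous_on N f \<and>
    (\<forall>p\<in>N. \<forall>v. (\<lambda>t. f (p + t *\<^sub>C v)) field_differentiable (at 0))"

definition nowhere_locally_zero_on :: "('v::complex_tvs \<Rightarrow> complex) \<Rightarrow> 'v set \<Rightarrow> bool"
  where "nowhere_locally_zero_on h N \<longleftrightarrow>
    (\<forall>W. open W \<and> W \<subseteq> N \<and> W \<noteq> {} \<longrightarrow> (\<exists>q\<in>W. h q \<noteq> 0))"

text \<open>A meromorphic function is locally a quotient \<open>g / h\<close> of holomorphic functions with \<open>h\<close> not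
  vanishing identically on any nonempty open set. It is represented by a total function whose
  values where \<open>h\<close> vanishes are irrelevant, and two such functions are identified if they agree on
  a dense open set.\<close>

definition is_meromorphic :: "('v::complex_tvs \<Rightarrow> complex) \<Rightarrow> bool"
  where "is_meromorphic f \<longleftrightarrow> (\<forall>p. \<exists>N g h. open N \<and> p \<in> N \<and>
    g tvs_holomorphic_on N \<and> h tvs_holomorphic_on N \<and> nowhere_locally_zero_on h N \<and>
    (\<forall>q\<in>N. h q \<noteq> 0 \<longrightarrow> f q = g q / h q))"

definition mero_eq :: "('v::complex_tvs \<Rightarrow> complex) \<Rightarrow> ('v \<Rightarrow> complex) \<Rightarrow> bool"
  where "mero_eq f g \<longleftrightarrow> is_meromorphic f \<and> is_meromorphic g \<and>
    (\<exists>D. open D \<and> closure D = UNIV \<and> (\<forall>q\<in>D. f q = g q))"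

definition dir_deriv :: "'v::complex_tvs \<Rightarrow> ('v \<Rightarrow> complex) \<Rightarrow> 'v \<Rightarrow> complex"
  where "dir_deriv v f p = deriv (\<lambda>t. f (p + t *\<^sub>C v)) 0"

lemma tvs_holomorphic_onD:
  assumes "f tvs_holomorphic_on N"
  shows "continuous_on N f" "p \<in> N \<Longrightarrow> (\<lambda>t. f (p + t *\<^sub>C v)) field_differentiable (at 0)"
  using assms by (simp_all add: tvs_holomorphic_on_def)

lemma tvs_holomorphic_on_line:
  assumes f: "f tvs_holomorphic_on N" and p: "p + s *\<^sub>C v \<in> N"
  shows "((\<lambda>t. f (p + t *\<^sub>C v)) has_field_derivative dir_deriv v f (p + s *\<^sub>C v)) (at s)"
proof -
  have "((\<lambda>t. f ((p + s *\<^sub>C v) + t *\<^sub>C v)) has_field_derivative dir_deriv v f (p + s *\<^sub>C v)) (at 0)"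
    unfolding dir_deriv_def
    using tvs_holomorphic_onD(2)[OF f p] by (simp add: field_differentiable_derivI)
  moreover have "(\<lambda>t. f ((p + s *\<^sub>C v) + t *\<^sub>C v)) = (\<lambda>t. f (p + (t + s) *\<^sub>C v))"
    by (simp add: scaleC_add_left add_ac)
  ultimately show ?thesis
    using DERIV_shift[of "\<lambda>t. f (p + t *\<^sub>C v)" _ 0 s] by simp
qed

lemma cauchy_kernel:
  fixes \<epsilon> :: real
  assumes "\<epsilon> > 0"
  obtains c K :: "real \<Rightarrow> complex" where
    "continuous_on {0..1} c" "continuous_on {0..1} K" "\<forall>x. c x \<in> cball 0 \<epsilon>"
    "\<forall>g. g holomorphic_on cball 0 \<epsilon> \<longrightarrow> deriv g 0 = integral {0..1} (\<lambda>x. g (c x) * K x)"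
proof -
  define c where "c = circlepath 0 \<epsilon>"
  define K where "K x = 2 * pi * \<i> * \<epsilon> * exp (2 * of_real pi * \<i> * x) / (c x)\<^sup>2 / (2 * pi * \<i>)" for x
  have c: "c x = \<epsilon> * exp (2 * of_real pi * \<i> * x)" for x
    by (simp add: c_def circlepath)
  then have c0: "c x \<noteq> 0" for x using assms by simp
  have contc: "continuous_on {0..1} c"
    unfolding c by (intro continuous_intros)
  moreover have "continuous_on {0..1} K"
    unfolding K_def using contc c0 by (intro continuous_intros) auto
  moreover have "c x \<in> cball 0 \<epsilon>" for x
    using assms by (simp add: c norm_mult)
  moreover have "deriv g 0 = integral {0..1} (\<lambda>x. g (c x) * K x)"
    if g: "g holomorphic_on cball 0 \<epsilon>" for g
  proof -
    have "2 * pi * \<i> * deriv g 0 = contour_integral c (\<lambda>u. g u / (u - 0)\<^sup>2)"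
      unfolding c_def
      by (rule Cauchy_contour_integral_circlepath_2[symmetric])
        (use g assms in \<open>auto intro: holomorphic_on_imp_continuous_on holomorphic_on_subset[OF g]\<close>)
    also have "\<dots> = integral {0..1} (\<lambda>x. (2 * pi * \<i>) * (g (c x) * K x))"
      unfolding contour_integral_integral
      by (rule integral_cong) (simp add: c_def[symmetric] K_def vector_derivative_circlepath[of 0 \<epsilon>, folded c_def])
    also have "\<dots> = (2 * pi * \<i>) * integral {0..1} (\<lambda>x. g (c x) * K x)"
      by (rule integral_mult_right)
    finally show ?thesis by simp
  qed
  ultimately show ?thesis by (intro that[of c K] allI impI)
qed

lemma tube_along_line:
  fixes p v :: "'v::complex_tvs"
  assumes "open N" "p \<in> N"
  obtains W \<epsilon> where "open W" "p \<in> W" "\<epsilon> > 0" "\<forall>q\<in>W. \<forall>s\<in>cball 0 \<epsilon>. q + s *\<^sub>C v \<in> N"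
proof -
  have "continuous_on UNIV (\<lambda>x::complex \<times> 'v. snd x + fst x *\<^sub>C v)"
    by (intro continuous_intros_tvs)
  then have "open ((\<lambda>x::complex \<times> 'v. snd x + fst x *\<^sub>C v) -` N)"
    using assms(1) open_vimage by blast
  moreover have "(0, p) \<in> (\<lambda>x::complex \<times> 'v. snd x + fst x *\<^sub>C v) -` N"
    using assms(2) by simp
  ultimately obtain A W where "open A" "open W" "(0, p) \<in> A \<times> W"
      "A \<times> W \<subseteq> (\<lambda>x::complex \<times> 'v. snd x + fst x *\<^sub>C v) -` N"
    by (rule open_prod_elim)
  then have AW: "open A" "open W" "0 \<in> A" "p \<in> W"
      "A \<times> W \<subseteq> (\<lambda>x::complex \<times> 'v. snd x + fst x *\<^sub>C v) -` N"
    by auto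
  obtain \<epsilon> where "\<epsilon> > 0" "cball 0 \<epsilon> \<subseteq> A"
    using AW open_contains_cball by blast
  with AW that[of W \<epsilon>] show ?thesis by (force simp: subset_iff)
qed

lemma tvs_holomorphic_on_ball:
  assumes "f tvs_holomorphic_on N" "\<And>s. s \<in> S \<Longrightarrow> q + s *\<^sub>C v \<in> N"
  shows "(\<lambda>s. f (q + s *\<^sub>C v)) holomorphic_on S"
  using assms tvs_holomorphic_on_line
  by (metis field_differentiable_at_within field_differentiable_def holomorphic_on_def)

lemma dir_deriv_integral:
  assumes f: "f tvs_holomorphic_on N" and N: "open N" and p: "p \<in> N"
  obtains W and c K :: "real \<Rightarrow> complex" where "open W" "p \<in> W" "continuous_on {0..1} c" "continuous_on {0..1} K"
    "\<forall>q\<in>W. \<forall>x. q + c x *\<^sub>C v \<in> N"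
    "\<forall>q\<in>W. dir_deriv v f q = integral (cbox 0 1) (\<lambda>x::real. f (q + c x *\<^sub>C v) * K x)"
proof -
  obtain W \<epsilon> where W: "open W" "p \<in> W" "\<epsilon> > 0" "\<forall>q\<in>W. \<forall>s\<in>cball 0 \<epsilon>. q + s *\<^sub>C v \<in> N"
    by (rule tube_along_line[OF N p, where v = v])
  obtain c K :: "real \<Rightarrow> complex" where cK: "continuous_on {0..1} c" "continuous_on {0..1} K" "\<forall>x. c x \<in> cball 0 \<epsilon>"
    "\<forall>g. g holomorphic_on cball 0 \<epsilon> \<longrightarrow> deriv g 0 = integral {0..1} (\<lambda>x. g (c x) * K x)"
    by (rule cauchy_kernel[OF W(3)])
  have *: "dir_deriv v f q = integral (cbox 0 1) (\<lambda>x. f (q + c x *\<^sub>C v) * K x)" if "q \<in> W" for q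
    using cK(4)[rule_format, OF tvs_holomorphic_on_ball[OF f W(4)[rule_format, OF that]]] by (simp add: dir_deriv_def)
  show ?thesis
    by (rule that[of W c K]) (use W(1,2) W(4)[rule_format, OF _ cK(3)[rule_format]] cK(1,2) * in auto)
qed

lemma continuous_on_dir_deriv:
  assumes f: "f tvs_holomorphic_on N" and N: "open N"
  shows "continuous_on N (dir_deriv v f)"
proof -
  have "\<exists>W. open W \<and> p \<in> W \<and> continuous_on W (dir_deriv v f)" if p: "p \<in> N" for p
  proof -
    obtain W c K where W: "open W" "p \<in> W" "continuous_on {0..1} c" "continuous_on {0..1} K"
      "\<forall>q\<in>W. \<forall>x. q + c x *\<^sub>C v \<in> N"
      "\<forall>q\<in>W. dir_deriv v f q = integral (cbox 0 1) (\<lambda>x::real. f (q + c x *\<^sub>C v) * K x)"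
      by (rule dir_deriv_integral[OF f N p, where v = v])
    have cs: "continuous_on (W \<times> cbox 0 1) (\<lambda>z. c (snd z))" "continuous_on (W \<times> cbox 0 1) (\<lambda>z. K (snd z))"
      by (rule continuous_on_compose2[OF W(3)] continuous_on_compose2[OF W(4)];
          auto intro: continuous_intros)+
    have "continuous_on (W \<times> cbox 0 1) (\<lambda>z. fst z + c (snd z) *\<^sub>C v)"
      by (intro continuous_intros_tvs cs)
    then have "continuous_on (W \<times> cbox 0 1) (\<lambda>z. f (fst z + c (snd z) *\<^sub>C v))"
      by (rule continuous_on_compose2[OF tvs_holomorphic_onD(1)[OF f]]) (use W(5) in auto)
    then have "continuous_on (W \<times> cbox 0 1) (\<lambda>(q, x). f (q + c x *\<^sub>C v) * K x)"
      unfolding case_prod_beta by (intro continuous_on_mult cs)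
    then have "continuous_on W (\<lambda>q. integral (cbox 0 1) (\<lambda>x. f (q + c x *\<^sub>C v) * K x))"
      by (rule integral_continuous_on_param)
    then have "continuous_on W (dir_deriv v f)"
      using W(6) by (simp cong: continuous_on_cong)
    then show ?thesis using W(1,2) by blast
  qed
  then have "N \<subseteq> \<Union>{W. open W \<and> continuous_on W (dir_deriv v f)}" by blast
  moreover have "continuous_on (\<Union>{W. open W \<and> continuous_on W (dir_deriv v f)}) (dir_deriv v f)"
    by (rule continuous_on_open_Union) auto
  ultimately show ?thesis by (rule continuous_on_subset[rotated])
qed

lemma tvs_holomorphic_on_dir_deriv:
  assumes f: "f tvs_holomorphic_on N" and N: "open N"
  shows "dir_deriv v f tvs_holomorphic_on N"
  unfolding tvs_holomorphic_on_def
proof (intro conjI ballI allI)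
  show "continuous_on N (dir_deriv v f)"
    using f N by (rule continuous_on_dir_deriv)
next
  fix p w assume p: "p \<in> N"
  obtain W c K where W: "open W" "p \<in> W" "continuous_on {0..1} c" "continuous_on {0..1} K"
    "\<forall>q\<in>W. \<forall>x. q + c x *\<^sub>C v \<in> N"
    "\<forall>q\<in>W. dir_deriv v f q = integral (cbox 0 1) (\<lambda>x::real. f (q + c x *\<^sub>C v) * K x)"
    by (rule dir_deriv_integral[OF f N p, where v = v])
  obtain W' \<delta> where W': "open W'" "p \<in> W'" "\<delta> > 0" "\<forall>q\<in>W'. \<forall>s\<in>cball 0 \<delta>. q + s *\<^sub>C w \<in> W"
    by (rule tube_along_line[OF W(1,2), where v = w])
  let ?B = "ball (0::complex) \<delta>"
  have inW: "p + t *\<^sub>C w \<in> W" if "t \<in> ?B" for t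
    using W'(4)[rule_format, OF W'(2)] that by simp
  have inN: "(p + c x *\<^sub>C v) + t *\<^sub>C w \<in> N" if "t \<in> ?B" for t x
    using W(5)[rule_format, OF inW[OF that]] by (simp add: add_ac)
  have cs: "continuous_on (?B \<times> cbox 0 1) (\<lambda>z. c (snd z))" "continuous_on (?B \<times> cbox 0 1) (\<lambda>z. K (snd z))"
    by (rule continuous_on_compose2[OF W(3)] continuous_on_compose2[OF W(4)];
        auto intro: continuous_intros)+
  have arg: "continuous_on (?B \<times> cbox 0 1) (\<lambda>z. (p + c (snd z) *\<^sub>C v) + fst z *\<^sub>C w)"
    by (intro continuous_on_plus_tvs continuous_on_scaleC_tvs continuous_on_const cs
        continuous_on_fst continuous_on_id)
  have "(\<lambda>t. integral (cbox 0 1) (\<lambda>x. f ((p + c x *\<^sub>C v) + t *\<^sub>C w) * K x)) holomorphic_on ?B"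
  proof (rule leibniz_rule_holomorphic)
    show "((\<lambda>t. f ((p + c x *\<^sub>C v) + t *\<^sub>C w) * K x) has_field_derivative
        dir_deriv w f ((p + c x *\<^sub>C v) + t *\<^sub>C w) * K x) (at t within ?B)" if "t \<in> ?B" for t x
      by (rule DERIV_cmult_right[OF has_field_derivative_at_within[OF
            tvs_holomorphic_on_line[OF f inN[OF that]]]])
    have "continuous_on (?B \<times> cbox 0 1) (\<lambda>z. dir_deriv w f ((p + c (snd z) *\<^sub>C v) + fst z *\<^sub>C w))"
      by (rule continuous_on_compose2[OF continuous_on_dir_deriv[OF f N] arg]) (use inN in auto)
    then show "continuous_on (?B \<times> cbox 0 1)
        (\<lambda>(t, x). dir_deriv w f ((p + c x *\<^sub>C v) + t *\<^sub>C w) * K x)"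
      unfolding case_prod_beta by (intro continuous_on_mult cs)
    have "continuous_on (?B \<times> cbox 0 1) (\<lambda>z. f ((p + c (snd z) *\<^sub>C v) + fst z *\<^sub>C w))"
      by (rule continuous_on_compose2[OF tvs_holomorphic_onD(1)[OF f] arg]) (use inN in auto)
    then have *: "continuous_on (?B \<times> cbox 0 1) (\<lambda>z. f ((p + c (snd z) *\<^sub>C v) + fst z *\<^sub>C w) * K (snd z))"
      by (intro continuous_on_mult cs)
    show "(\<lambda>x. f ((p + c x *\<^sub>C v) + t *\<^sub>C w) * K x) integrable_on cbox 0 1" if "t \<in> ?B" for t
    proof (rule integrable_continuous)
      have "continuous_on (cbox 0 1) (\<lambda>x::real. (t, x))" by (intro continuous_intros)
      moreover have "Pair t ` cbox 0 1 \<subseteq> ?B \<times> cbox (0::real) 1" using that by auto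
      ultimately show "continuous_on (cbox 0 1) (\<lambda>x. f ((p + c x *\<^sub>C v) + t *\<^sub>C w) * K x)"
        using continuous_on_compose2[OF *] by force
    qed
  qed simp
  then have "(\<lambda>t. dir_deriv v f (p + t *\<^sub>C w)) holomorphic_on ?B"
    by (rule holomorphic_transform) (simp add: W(6)[rule_format, OF inW] add_ac)
  then show "(\<lambda>t. dir_deriv v f (p + t *\<^sub>C w)) field_differentiable (at 0)"
    using W'(3) by (simp add: holomorphic_on_imp_differentiable_at)
qed

lemma tvs_holomorphic_on_const: "(\<lambda>_. c) tvs_holomorphic_on N"
  by (simp add: tvs_holomorphic_on_def)

lemma tvs_holomorphic_on_add:
  "f tvs_holomorphic_on N \<Longrightarrow> g tvs_holomorphic_on N \<Longrightarrow> (\<lambda>p. f p + g p) tvs_holomorphic_on N"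
  by (auto simp: tvs_holomorphic_on_def intro: continuous_on_add field_differentiable_add)

lemma tvs_holomorphic_on_diff:
  "f tvs_holomorphic_on N \<Longrightarrow> g tvs_holomorphic_on N \<Longrightarrow> (\<lambda>p. f p - g p) tvs_holomorphic_on N"
  by (auto simp: tvs_holomorphic_on_def intro: continuous_on_diff field_differentiable_diff)

lemma tvs_holomorphic_on_mult:
  "f tvs_holomorphic_on N \<Longrightarrow> g tvs_holomorphic_on N \<Longrightarrow> (\<lambda>p. f p * g p) tvs_holomorphic_on N"
  by (auto simp: tvs_holomorphic_on_def intro: continuous_on_mult field_differentiable_mult)

lemma tvs_holomorphic_on_subset: "f tvs_holomorphic_on N \<Longrightarrow> M \<subseteq> N \<Longrightarrow> f tvs_holomorphic_on M"
  by (auto simp: tvs_holomorphic_on_def intro: continuous_on_subset)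

lemma nowhere_locally_zero_on_subset:
  "nowhere_locally_zero_on h N \<Longrightarrow> M \<subseteq> N \<Longrightarrow> nowhere_locally_zero_on h M"
  by (meson nowhere_locally_zero_on_def order_trans)

lemma nowhere_locally_zero_on_mult:
  assumes "continuous_on N h" "nowhere_locally_zero_on h N" "nowhere_locally_zero_on k N"
  shows "nowhere_locally_zero_on (\<lambda>p. h p * k p) N"
  unfolding nowhere_locally_zero_on_def
proof (intro allI impI)
  fix W assume W: "open W \<and> W \<subseteq> N \<and> W \<noteq> {}"
  let ?W = "W \<inter> h -` (- {0})"
  have "open ?W"
    using W by (intro continuous_open_preimage continuous_on_subset[OF assms(1)] open_Compl
        closed_singleton) auto
  moreover have "?W \<noteq> {}"
    using assms(2) W by (auto simp: nowhere_locally_zero_on_def)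
  ultimately obtain q where "q \<in> ?W" "k q \<noteq> 0"
    using assms(3) W unfolding nowhere_locally_zero_on_def by (metis Int_lower1 order_trans)
  then show "\<exists>q\<in>W. h q * k q \<noteq> 0" by auto
qed

lemma is_meromorphic_const: "is_meromorphic (\<lambda>_. c)"
  unfolding is_meromorphic_def
proof
  fix p :: 'a
  have "nowhere_locally_zero_on (\<lambda>_::'a. 1) UNIV"
    by (auto simp: nowhere_locally_zero_on_def)
  then show "\<exists>N g h. open N \<and> p \<in> N \<and> g tvs_holomorphic_on N \<and> h tvs_holomorphic_on N \<and>
      nowhere_locally_zero_on h N \<and> (\<forall>q\<in>N. h q \<noteq> 0 \<longrightarrow> c = g q / h q)"
    by (intro exI[of _ UNIV] exI[of _ "\<lambda>_. c"] exI[of _ "\<lambda>_. 1"])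
      (simp add: tvs_holomorphic_on_const)
qed

lemma is_meromorphic_add_mult:
  assumes "is_meromorphic f" "is_meromorphic g"
  shows "is_meromorphic (\<lambda>p. f p + g p)" "is_meromorphic (\<lambda>p. f p * g p)"
proof -
  {
    fix p
    from assms(1) obtain N1 a h where 1: "open N1" "p \<in> N1" "a tvs_holomorphic_on N1"
      "h tvs_holomorphic_on N1" "nowhere_locally_zero_on h N1" "\<And>q. q \<in> N1 \<Longrightarrow> h q \<noteq> 0 \<Longrightarrow> f q = a q / h q"
      unfolding is_meromorphic_def by metis
    from assms(2) obtain N2 b k where 2: "open N2" "p \<in> N2" "b tvs_holomorphic_on N2"
      "k tvs_holomorphic_on N2" "nowhere_locally_zero_on k N2" "\<And>q. q \<in> N2 \<Longrightarrow> k q \<noteq> 0 \<Longrightarrow> g q = b q / k q"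
      unfolding is_meromorphic_def by metis
    let ?N = "N1 \<inter> N2"
    have hol: "a tvs_holomorphic_on ?N" "h tvs_holomorphic_on ?N" "b tvs_holomorphic_on ?N" "k tvs_holomorphic_on ?N"
      using 1(3,4) 2(3,4) by (auto intro: tvs_holomorphic_on_subset)
    have nz: "nowhere_locally_zero_on (\<lambda>p. h p * k p) ?N"
      by (rule nowhere_locally_zero_on_mult)
        (use 1(5) 2(5) hol(2) in \<open>auto intro: nowhere_locally_zero_on_subset tvs_holomorphic_onD\<close>)
    have op: "open ?N" "p \<in> ?N" using 1 2 by auto
    have "\<exists>N g' h'. open N \<and> p \<in> N \<and> g' tvs_holomorphic_on N \<and> h' tvs_holomorphic_on N \<and>
        nowhere_locally_zero_on h' N \<and> (\<forall>q\<in>N. h' q \<noteq> 0 \<longrightarrow> f q + g q = g' q / h' q)"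
      by (intro exI[of _ ?N] exI[of _ "\<lambda>p. a p * k p + b p * h p"] exI[of _ "\<lambda>p. h p * k p"] conjI
          op nz hol tvs_holomorphic_on_add tvs_holomorphic_on_mult)
        (auto simp: 1(6) 2(6) field_simps)
    moreover have "\<exists>N g' h'. open N \<and> p \<in> N \<and> g' tvs_holomorphic_on N \<and> h' tvs_holomorphic_on N \<and>
        nowhere_locally_zero_on h' N \<and> (\<forall>q\<in>N. h' q \<noteq> 0 \<longrightarrow> f q * g q = g' q / h' q)"
      by (intro exI[of _ ?N] exI[of _ "\<lambda>p. a p * b p"] exI[of _ "\<lambda>p. h p * k p"] conjI
          op nz hol tvs_holomorphic_on_mult)
        (auto simp: 1(6) 2(6) field_simps)
    ultimately have "(\<exists>N g' h'. open N \<and> p \<in> N \<and> g' tvs_holomorphic_on N \<and> h' tvs_holomorphic_on N \<and>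
        nowhere_locally_zero_on h' N \<and> (\<forall>q\<in>N. h' q \<noteq> 0 \<longrightarrow> f q + g q = g' q / h' q)) \<and>
      (\<exists>N g' h'. open N \<and> p \<in> N \<and> g' tvs_holomorphic_on N \<and> h' tvs_holomorphic_on N \<and>
        nowhere_locally_zero_on h' N \<and> (\<forall>q\<in>N. h' q \<noteq> 0 \<longrightarrow> f q * g q = g' q / h' q))" by (rule conjI)
  }
  then show "is_meromorphic (\<lambda>p. f p + g p)" "is_meromorphic (\<lambda>p. f p * g p)"
    unfolding is_meromorphic_def by blast+
qed

lemma quotient_has_dir_deriv:
  assumes N: "open N" "g tvs_holomorphic_on N" "h tvs_holomorphic_on N"
    and f: "\<And>q. q \<in> N \<Longrightarrow> h q \<noteq> 0 \<Longrightarrow> f q = g q / h q" and q: "q \<in> N" "h q \<noteq> 0"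
  shows "((\<lambda>t. f (q + t *\<^sub>C v)) has_field_derivative
    (dir_deriv v g q * h q - g q * dir_deriv v h q) / (h q * h q)) (at 0)"
proof -
  have "open (N \<inter> h -` (- {0}))"
    by (intro continuous_open_preimage tvs_holomorphic_onD(1)[OF N(3)] N(1) open_Compl
        closed_singleton)
  moreover have "q \<in> N \<inter> h -` (- {0})" using q by simp
  ultimately obtain W \<epsilon> where W: "open W" "q \<in> W" "\<epsilon> > 0"
      "\<forall>q\<in>W. \<forall>s\<in>cball 0 \<epsilon>. q + s *\<^sub>C v \<in> N \<inter> h -` (- {0})"
    by (rule tube_along_line[where v = v])
  have ev: "\<forall>\<^sub>F t in nhds 0. f (q + t *\<^sub>C v) = g (q + t *\<^sub>C v) / h (q + t *\<^sub>C v)"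
    unfolding eventually_nhds
    by (rule exI[of _ "ball 0 \<epsilon>"]) (use W(3) W(4)[rule_format, OF W(2)] f in auto)
  have "((\<lambda>t. g (q + t *\<^sub>C v) / h (q + t *\<^sub>C v)) has_field_derivative
      (dir_deriv v g q * h q - g q * dir_deriv v h q) / (h q * h q)) (at 0)"
    using tvs_holomorphic_on_line[OF N(2), of q 0 v] tvs_holomorphic_on_line[OF N(3), of q 0 v] q
    by (intro derivative_eq_intros | simp)+
  then show ?thesis
    using DERIV_cong_ev[OF refl ev refl] by blast
qed

lemma is_meromorphic_dir_deriv:
  assumes "is_meromorphic f"
  shows "is_meromorphic (dir_deriv v f)"
  unfolding is_meromorphic_def
proof
  fix p
  from assms obtain N g h where N: "open N" "p \<in> N" "g tvs_holomorphic_on N"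
    "h tvs_holomorphic_on N" "nowhere_locally_zero_on h N" "\<And>q. q \<in> N \<Longrightarrow> h q \<noteq> 0 \<Longrightarrow> f q = g q / h q"
    unfolding is_meromorphic_def by metis
  have "dir_deriv v f q = (dir_deriv v g q * h q - g q * dir_deriv v h q) / (h q * h q)"
    if q: "q \<in> N" "h q \<noteq> 0" for q
    unfolding dir_deriv_def[of v f]
    by (rule DERIV_imp_deriv[OF quotient_has_dir_deriv[OF N(1,3,4,6) q]])
  then show "\<exists>N g h. open N \<and> p \<in> N \<and> g tvs_holomorphic_on N \<and> h tvs_holomorphic_on N \<and>
      nowhere_locally_zero_on h N \<and> (\<forall>q\<in>N. h q \<noteq> 0 \<longrightarrow> dir_deriv v f q = g q / h q)"
    using N
    by (intro exI[of _ N] exI[of _ "\<lambda>q. dir_deriv v g q * h q - g q * dir_deriv v h q"]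
        exI[of _ "\<lambda>q. h q * h q"] conjI tvs_holomorphic_on_diff tvs_holomorphic_on_mult
        tvs_holomorphic_on_dir_deriv nowhere_locally_zero_on_mult tvs_holomorphic_onD(1)) auto
qed

lemma is_meromorphic_differentiable:
  assumes "is_meromorphic f"
  shows "\<exists>D. open D \<and> closure D = UNIV \<and>
    (\<forall>q\<in>D. \<forall>v. (\<lambda>t. f (q + t *\<^sub>C v)) field_differentiable (at 0))"
proof -
  define D where "D = \<Union>{W. open W \<and> (\<forall>q\<in>W. \<forall>v. (\<lambda>t. f (q + t *\<^sub>C v)) field_differentiable (at 0))}"
  have "open D" unfolding D_def by blast
  have meets: "V \<inter> D \<noteq> {}" if V: "open V" "p \<in> V" for V p
  proof -
    from assms obtain N g h where N: "open N" "p \<in> N" "g tvs_holomorphic_on N"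
      "h tvs_holomorphic_on N" "nowhere_locally_zero_on h N" "\<And>q. q \<in> N \<Longrightarrow> h q \<noteq> 0 \<Longrightarrow> f q = g q / h q"
      unfolding is_meromorphic_def by metis
    let ?W = "N \<inter> h -` (- {0})"
    have "open ?W"
      by (intro continuous_open_preimage tvs_holomorphic_onD(1)[OF N(4)] N(1) open_Compl
          closed_singleton)
    moreover have "(\<lambda>t. f (q + t *\<^sub>C v)) field_differentiable (at 0)" if "q \<in> ?W" for q v
      using quotient_has_dir_deriv[OF N(1,3,4,6), of q] that by (auto simp: field_differentiable_def)
    ultimately have "?W \<subseteq> D" unfolding D_def by blast
    have "open (V \<inter> N)" "V \<inter> N \<subseteq> N" "V \<inter> N \<noteq> {}" using V N by auto
    then obtain q where "q \<in> V \<inter> N" "h q \<noteq> 0"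
      using N(5) unfolding nowhere_locally_zero_on_def by blast
    then have "q \<in> V \<inter> ?W" by simp
    then show ?thesis using \<open>?W \<subseteq> D\<close> by blast
  qed
  have "closure D = UNIV"
  proof (rule ccontr)
    assume "closure D \<noteq> UNIV"
    then obtain p where "p \<in> - closure D" by blast
    then have "- closure D \<inter> D \<noteq> {}" by (intro meets[of _ p]) auto
    then show False using closure_subset by blast
  qed
  with \<open>open D\<close> show ?thesis unfolding D_def by blast
qed

lemma mero_eq_refl_iff: "mero_eq f f \<longleftrightarrow> is_meromorphic f"
  by (auto simp: mero_eq_def intro!: exI[of _ UNIV])

lemma closure_Int_dense:
  assumes "open D" "closure D = UNIV" "open E" "closure E = UNIV"
  shows "open (D \<inter> E)" "closure (D \<inter> E) = UNIV"
  using assms closure_open_Int_superset[of D E] by auto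

lemma mero_eq_binary:
  assumes "mero_eq f f'" "mero_eq g g'"
    and "is_meromorphic (\<lambda>p. F (f p) (g p))" "is_meromorphic (\<lambda>p. F (f' p) (g' p))"
  shows "mero_eq (\<lambda>p. F (f p) (g p)) (\<lambda>p. F (f' p) (g' p))"
proof -
  obtain D E where "open D" "closure D = UNIV" "\<forall>q\<in>D. f q = f' q"
    "open E" "closure E = UNIV" "\<forall>q\<in>E. g q = g' q"
    using assms(1,2) unfolding mero_eq_def by metis
  then show ?thesis
    unfolding mero_eq_def using assms(3,4) closure_Int_dense[of D E]
    by (intro conjI exI[of _ "D \<inter> E"]) auto
qed

lemma mero_eq_dir_deriv:
  assumes "mero_eq f g"
  shows "mero_eq (dir_deriv v f) (dir_deriv v g)"
proof -
  obtain D where D: "open D" "closure D = UNIV" "\<forall>q\<in>D. f q = g q"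
    using assms unfolding mero_eq_def by metis
  have "dir_deriv v f q = dir_deriv v g q" if q: "q \<in> D" for q
  proof -
    obtain W \<epsilon> where W: "open W" "q \<in> W" "\<epsilon> > 0" "\<forall>q\<in>W. \<forall>s\<in>cball 0 \<epsilon>. q + s *\<^sub>C v \<in> D"
      by (rule tube_along_line[OF D(1) q, where v = v])
    have "\<forall>\<^sub>F t in nhds 0. f (q + t *\<^sub>C v) = g (q + t *\<^sub>C v)"
      unfolding eventually_nhds
      by (rule exI[of _ "ball 0 \<epsilon>"]) (use W(3) W(4)[rule_format, OF W(2)] D(3) in auto)
    then show ?thesis unfolding dir_deriv_def by (intro deriv_cong_ev) simp_all
  qed
  then show ?thesis
    using assms D is_meromorphic_dir_deriv unfolding mero_eq_def by blast
qed

quotient_type (overloaded) 'v mero = "'v::complex_tvs \<Rightarrow> complex" / partial: mero_eq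
proof (rule part_equivpI)
  show "\<exists>f::'v \<Rightarrow> complex. mero_eq f f"
    using is_meromorphic_const mero_eq_refl_iff by blast
  show "symp (mero_eq :: ('v \<Rightarrow> complex) \<Rightarrow> _)"
    by (auto simp: symp_def mero_eq_def)
  show "transp (mero_eq :: ('v \<Rightarrow> complex) \<Rightarrow> _)"
  proof (rule transpI)
    fix f g h :: "'v \<Rightarrow> complex"
    assume fg: "mero_eq f g" "mero_eq g h"
    then obtain D E where "open D" "closure D = UNIV" "\<forall>q\<in>D. f q = g q"
      "open E" "closure E = UNIV" "\<forall>q\<in>E. g q = h q"
      unfolding mero_eq_def by metis
    with fg closure_Int_dense[of D E] show "mero_eq f h"
      unfolding mero_eq_def by (intro conjI exI[of _ "D \<inter> E"]) auto
  qed
qed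

instantiation mero :: (complex_tvs) "{complex_algebra_1, comm_ring}"
begin

lift_definition zero_mero :: "'a mero" is "\<lambda>_. 0"
  by (simp add: mero_eq_refl_iff is_meromorphic_const)

lift_definition one_mero :: "'a mero" is "\<lambda>_. 1"
  by (simp add: mero_eq_refl_iff is_meromorphic_const)

lift_definition plus_mero :: "'a mero \<Rightarrow> 'a mero \<Rightarrow> 'a mero" is "\<lambda>f g p. f p + g p"
  by (rule mero_eq_binary[where F = "(+)"])
    (auto intro: is_meromorphic_add_mult simp: mero_eq_def)

lift_definition times_mero :: "'a mero \<Rightarrow> 'a mero \<Rightarrow> 'a mero" is "\<lambda>f g p. f p * g p"
  by (rule mero_eq_binary[where F = "(*)"])
    (auto intro: is_meromorphic_add_mult simp: mero_eq_def)

lift_definition scaleC_mero :: "complex \<Rightarrow> 'a mero \<Rightarrow> 'a mero" is "\<lambda>c f p. c * f p"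
  subgoal for c f g
    by (rule mero_eq_binary[where F = "\<lambda>x y. c * x"])
      (auto intro: is_meromorphic_add_mult is_meromorphic_const simp: mero_eq_def)
  done

definition uminus_mero :: "'a mero \<Rightarrow> 'a mero" where "- f = (-1) *\<^sub>C (f::'a mero)"

definition minus_mero :: "'a mero \<Rightarrow> 'a mero \<Rightarrow> 'a mero" where "f - g = f + - (g::'a mero)"

instance
proof
  fix f g h :: "'a mero" and c d :: complex
  note [simp] = mero_eq_refl_iff is_meromorphic_add_mult is_meromorphic_const
  show "f + g + h = f + (g + h)" by transfer (simp add: add.assoc)
  show "f + g = g + f" by transfer (simp add: add.commute)
  show "0 + f = f" by transfer simp
  show "- f + f = 0" unfolding uminus_mero_def by transfer simp
  show "f - g = f + - g" by (rule minus_mero_def)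
  show "c *\<^sub>C (f + g) = c *\<^sub>C f + c *\<^sub>C g" by transfer (simp add: distrib_left)
  show "(c + d) *\<^sub>C f = c *\<^sub>C f + d *\<^sub>C f" by transfer (simp add: distrib_right)
  show "c *\<^sub>C d *\<^sub>C f = (c * d) *\<^sub>C f" by transfer (simp add: mult.assoc)
  show "1 *\<^sub>C f = f" by transfer simp
  show "f * g * h = f * (g * h)" by transfer (simp add: mult.assoc)
  show "f * g = g * f" by transfer (simp add: mult.commute)
  show "(f + g) * h = f * h + g * h" by transfer (simp add: distrib_right)
  show "f * (g + h) = f * g + f * h" by transfer (simp add: distrib_left)
  show "1 * f = f" "f * 1 = f" by (transfer, simp)+
  show "(c *\<^sub>C f) * g = c *\<^sub>C (f * g)" by transfer (simp add: mult.assoc)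
  show "f * (c *\<^sub>C g) = c *\<^sub>C (f * g)" by transfer (simp add: mult.left_commute)
qed

end

lift_definition mero_dir_deriv :: "'v::complex_tvs \<Rightarrow> 'v mero \<Rightarrow> 'v mero" is dir_deriv
  by (rule mero_eq_dir_deriv)

lemma clinear_mero_dir_deriv: "clinear (mero_dir_deriv v)"
proof (rule clinearI)
  show "mero_dir_deriv v (f + g) = mero_dir_deriv v f + mero_dir_deriv v g" for f g :: "'a mero"
  proof transfer
    fix v :: 'a and f g :: "'a \<Rightarrow> complex"
    assume "mero_eq f f" "mero_eq g g"
    then have fg: "is_meromorphic f" "is_meromorphic g" by (simp_all add: mero_eq_refl_iff)
    then obtain D E where "open D" "closure D = UNIV" "open E" "closure E = UNIV"
      and D: "\<forall>q\<in>D. \<forall>v. (\<lambda>t. f (q + t *\<^sub>C v)) field_differentiable (at 0)"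
      and E: "\<forall>q\<in>E. \<forall>v. (\<lambda>t. g (q + t *\<^sub>C v)) field_differentiable (at 0)"
      by (metis is_meromorphic_differentiable)
    moreover have "dir_deriv v (\<lambda>p. f p + g p) q = dir_deriv v f q + dir_deriv v g q"
      if "q \<in> D \<inter> E" for q
      using that D E unfolding dir_deriv_def by (intro deriv_add) auto
    ultimately show "mero_eq (dir_deriv v (\<lambda>p. f p + g p)) (\<lambda>p. dir_deriv v f p + dir_deriv v g p)"
      unfolding mero_eq_def using fg closure_Int_dense[of D E]
      by (intro conjI exI[of _ "D \<inter> E"] is_meromorphic_dir_deriv is_meromorphic_add_mult) auto
  qed
  show "mero_dir_deriv v (c *\<^sub>C f) = c *\<^sub>C mero_dir_deriv v f" for c and f :: "'a mero"
  proof transfer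
    fix v :: 'a and c and f :: "'a \<Rightarrow> complex"
    assume "mero_eq f f"
    then have f: "is_meromorphic f" by (simp add: mero_eq_refl_iff)
    then obtain D where "open D" "closure D = UNIV"
      and D: "\<forall>q\<in>D. \<forall>v. (\<lambda>t. f (q + t *\<^sub>C v)) field_differentiable (at 0)"
      by (metis is_meromorphic_differentiable)
    moreover have "dir_deriv v (\<lambda>p. c * f p) q = c * dir_deriv v f q" if "q \<in> D" for q
      using that D unfolding dir_deriv_def by (intro deriv_cmult) auto
    ultimately show "mero_eq (dir_deriv v (\<lambda>p. c * f p)) (\<lambda>p. c * dir_deriv v f p)"
      unfolding mero_eq_def using f
      by (intro conjI exI[of _ D] is_meromorphic_dir_deriv is_meromorphic_add_mult
          is_meromorphic_const) auto
  qed
qed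


section \<open>The dual space\<close>

text \<open>The topology of pointwise convergence is, for finite dimensional \<open>'a\<close>, the usual topology of the
  dual space.\<close>

typedef (overloaded) 'a dual = "{f :: 'a::complex_vector \<Rightarrow> complex. clinear f}"
  morphisms dual_apply Abs_dual
  by (rule exI[of _ "\<lambda>_. 0"]) (simp add: clinear_iff)

lemma clinear_dual_apply: "clinear (dual_apply \<phi>)"
  using dual_apply by blast

instantiation dual :: (complex_vector) "{complex_vector, topological_space}"
begin

definition "0 = Abs_dual (\<lambda>_. 0)"
definition "\<phi> + \<psi> = Abs_dual (\<lambda>a. dual_apply \<phi> a + dual_apply \<psi> a)"
definition "- \<phi> = Abs_dual (\<lambda>a. - dual_apply \<phi> a)"
definition "\<phi> - \<psi> = Abs_dual (\<lambda>a. dual_apply \<phi> a - dual_apply \<psi> a)"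
definition "c *\<^sub>C \<phi> = Abs_dual (\<lambda>a. c * dual_apply \<phi> a)"
definition open_dual :: "'a dual set \<Rightarrow> bool"
  where "open_dual U \<longleftrightarrow> (\<exists>V. open V \<and> U = dual_apply -` V)"

lemma dual_apply_simps:
  fixes \<phi> \<psi> :: "'a dual"
  shows "dual_apply 0 = (\<lambda>a::'a. 0)"
    and "dual_apply (\<phi> + \<psi>) = (\<lambda>a. dual_apply \<phi> a + dual_apply \<psi> a)"
    and "dual_apply (- \<phi>) = (\<lambda>a. - dual_apply \<phi> a)"
    and "dual_apply (\<phi> - \<psi>) = (\<lambda>a. dual_apply \<phi> a - dual_apply \<psi> a)"
    and "dual_apply (c *\<^sub>C \<phi>) = (\<lambda>a. c * dual_apply \<phi> a)"
  unfolding zero_dual_def plus_dual_def uminus_dual_def minus_dual_def scaleC_dual_def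
  by (rule Abs_dual_inverse, insert clinear_dual_apply[of \<phi>] clinear_dual_apply[of \<psi>],
      simp add: clinear_iff scaleC_complex_def algebra_simps)+

instance
proof
  show "open (UNIV :: 'a dual set)"
    unfolding open_dual_def by (rule exI[of _ UNIV]) simp
  show "open (S \<inter> T)" if "open S" "open T" for S T :: "'a dual set"
    using that unfolding open_dual_def by (metis open_Int vimage_Int)
  show "open (\<Union>K)" if "\<forall>S\<in>K. open S" for K :: "'a dual set set"
  proof -
    from that obtain V where V: "\<And>S. S \<in> K \<Longrightarrow> open (V S) \<and> S = dual_apply -` V S"
      unfolding open_dual_def by metis
    then have "open (\<Union>(V ` K))" "\<Union>K = dual_apply -` \<Union>(V ` K)" by blast+
    then show ?thesis unfolding open_dual_def by blast
  qed
qed (simp_all add: dual_apply_inject[symmetric] dual_apply_simps fun_eq_iff algebra_simps)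

end

lemma tendsto_dual:
  assumes "\<And>a. ((\<lambda>z. dual_apply (f z) a) \<longlongrightarrow> dual_apply \<phi> a) F"
  shows "(f \<longlongrightarrow> \<phi>) F"
proof (rule topological_tendstoI)
  fix U :: "'a dual set" assume "open U" "\<phi> \<in> U"
  then obtain V where V: "open V" "U = dual_apply -` V"
    unfolding open_dual_def by blast
  have "limitin (product_topology (\<lambda>_. euclidean) UNIV) (\<lambda>z. dual_apply (f z)) (dual_apply \<phi>) F"
    using assms by (simp add: limitin_componentwise)
  then have "((\<lambda>z. dual_apply (f z)) \<longlongrightarrow> dual_apply \<phi>) F"
    by (simp add: euclidean_product_topology)
  then show "\<forall>\<^sub>F z in F. f z \<in> U"
    using V \<open>\<phi> \<in> U\<close> by (auto dest: topological_tendstoD)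
qed

lemma tendsto_dual_apply: "((\<lambda>\<psi>. dual_apply \<psi> a) \<longlongrightarrow> dual_apply \<phi> a) (nhds \<phi>)"
proof (rule topological_tendstoI)
  fix S :: "complex set" assume S: "open S" "dual_apply \<phi> a \<in> S"
  have "open ((\<lambda>f::'a \<Rightarrow> complex. f a) -` S)"
    using S(1) by (intro open_vimage continuous_on_product_coordinates)
  then have "open (dual_apply -` ((\<lambda>f. f a) -` S))"
    unfolding open_dual_def by blast
  then show "\<forall>\<^sub>F \<psi> in nhds \<phi>. dual_apply \<psi> a \<in> S"
    using S(2) by (auto simp: eventually_nhds)
qed

instance dual :: (complex_vector) complex_tvs
proof
  note ap = filterlim_compose[OF tendsto_dual_apply]
  show "LIM z nhds \<phi> \<times>\<^sub>F nhds \<psi>. fst z + snd z :> nhds (\<phi> + \<psi>)" for \<phi> \<psi> :: "'a dual"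
    by (rule tendsto_dual, unfold dual_apply_simps)
      (rule tendsto_add ap[OF filterlim_fst] ap[OF filterlim_snd])+
  show "LIM z nhds c \<times>\<^sub>F nhds \<phi>. fst z *\<^sub>C snd z :> nhds (c *\<^sub>C \<phi>)" for c and \<phi> :: "'a dual"
    by (rule tendsto_dual, unfold dual_apply_simps)
      (rule tendsto_mult filterlim_fst ap[OF filterlim_snd])+
qed



section \<open>Meromorphic functions with values in an algebra\<close>

text \<open>For \<open>\<aa>\<close> of type \<open>'a\<close> and a complex algebra \<open>'b\<close>, the meromorphic functions from the dual of
  \<open>\<aa>\<close> to \<open>'b\<close> are the elements of the algebra \<open>'a dual mero \<otimes> 'b\<close>.\<close>

definition pointwise ::
    "('b::complex_vector \<Rightarrow> 'c::complex_vector) \<Rightarrow> 'v::complex_tvs mero \<otimes> 'b \<Rightarrow> 'v mero \<otimes> 'c"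
  where "pointwise f = tensor_map (\<lambda>g. g) f"

definition mero_const :: "'b::complex_vector \<Rightarrow> 'v::complex_tvs mero \<otimes> 'b"
  where "mero_const b = 1 \<otimes> b"

definition mero_partial ::
    "'v::complex_tvs \<Rightarrow> 'v mero \<otimes> 'b::complex_vector \<Rightarrow> 'v mero \<otimes> 'b"
  where "mero_partial v = tensor_map (mero_dir_deriv v) (\<lambda>b. b)"

text \<open>\<open>x 1, \<dots>, x d\<close> is a basis of \<open>\<aa>\<close> with dual basis \<open>lam 1, \<dots>, lam d\<close>, and \<open>\<iota>\<close> embeds \<open>\<aa>\<close> in \<open>U\<close>.\<close>

definition dual_bases :: "nat \<Rightarrow> (nat \<Rightarrow> 'a::complex_vector) \<Rightarrow> (nat \<Rightarrow> 'a dual) \<Rightarrow> bool"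
  where "dual_bases d x lam \<longleftrightarrow>
    inj_on x {1..d} \<and> cindependent (x ` {1..d}) \<and> cspan (x ` {1..d}) = UNIV \<and>
    (\<forall>i\<in>{1..d}. \<forall>j\<in>{1..d}. dual_apply (lam i) (x j) = (if i = j then 1 else 0))"

text \<open>The operator \<open>E\<close>; \<open>pos\<close> places an element of \<open>U\<close> in one of the tensor positions.\<close>

definition mero_E ::
    "('a::complex_vector \<Rightarrow> 'u) \<Rightarrow> nat \<Rightarrow> (nat \<Rightarrow> 'a) \<Rightarrow> (nat \<Rightarrow> 'a dual) \<Rightarrow>
      ('u::complex_algebra_1 \<Rightarrow> 'b::complex_algebra_1) \<Rightarrow>
      'a dual mero \<otimes> 'b \<Rightarrow> 'a dual mero \<otimes> 'b"
  where "mero_E \<iota> d x lam pos F =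
    (\<Sum>k=1..d. mero_const (pos (\<iota> (x k))) * mero_partial (lam k) F)"


section \<open>Classical dynamical r-matrices\<close>

text \<open>Placements in \<open>U \<otimes> U \<otimes> U\<close>, with positions \<open>1, 2, 3\<close>.\<close>

definition yb_pos1 :: "'u::complex_algebra_1 \<Rightarrow> 'u \<otimes> 'u \<otimes> 'u"
  where "yb_pos1 u = u \<otimes> 1 \<otimes> 1"
definition yb_pos2 :: "'u::complex_algebra_1 \<Rightarrow> 'u \<otimes> 'u \<otimes> 'u"
  where "yb_pos2 u = 1 \<otimes> u \<otimes> 1"
definition yb_pos3 :: "'u::complex_algebra_1 \<Rightarrow> 'u \<otimes> 'u \<otimes> 'u"
  where "yb_pos3 u = 1 \<otimes> 1 \<otimes> u"
definition yb_pos12 :: "'u::complex_algebra_1 \<otimes> 'u \<Rightarrow> 'u \<otimes> 'u \<otimes> 'u"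
  where "yb_pos12 = tensor_map (\<lambda>a. a) (\<lambda>b. b \<otimes> 1)"
definition yb_pos13 :: "'u::complex_algebra_1 \<otimes> 'u \<Rightarrow> 'u \<otimes> 'u \<otimes> 'u"
  where "yb_pos13 = tensor_map (\<lambda>a. a) (\<lambda>b. 1 \<otimes> b)"
definition yb_pos23 :: "'u::complex_algebra_1 \<otimes> 'u \<Rightarrow> 'u \<otimes> 'u \<otimes> 'u"
  where "yb_pos23 t = 1 \<otimes> t"

lemma yb_pos_pure:
  "yb_pos12 (a \<otimes> b) = a \<otimes> b \<otimes> 1"
  "yb_pos13 (a \<otimes> b) = a \<otimes> 1 \<otimes> b"
  "yb_pos23 (a \<otimes> b) = 1 \<otimes> a \<otimes> b"
  unfolding yb_pos12_def yb_pos13_def yb_pos23_def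
  by (simp_all add: tensor_map_pure clinear_id clinear_tensor_left clinear_tensor_right)

definition YB ::
    "('a::complex_vector \<Rightarrow> 'u::complex_algebra_1) \<Rightarrow> nat \<Rightarrow> (nat \<Rightarrow> 'a) \<Rightarrow> (nat \<Rightarrow> 'a dual) \<Rightarrow>
      'a dual mero \<otimes> ('u \<otimes> 'u) \<Rightarrow> 'a dual mero \<otimes> ('u \<otimes> 'u \<otimes> 'u)"
  where "YB \<iota> d x lam r =
    (let r12 = pointwise yb_pos12 r; r13 = pointwise yb_pos13 r; r23 = pointwise yb_pos23 r;
         E = mero_E \<iota> d x lam
     in commutator r12 r13 + commutator r12 r23 + commutator r13 r23
        + E yb_pos1 r23 - E yb_pos2 r13 + E yb_pos3 r12)"

definition classical_dynamical_r_matrix ::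
    "('a::complex_vector \<Rightarrow> 'u::complex_algebra_1) \<Rightarrow> nat \<Rightarrow> (nat \<Rightarrow> 'a) \<Rightarrow> (nat \<Rightarrow> 'a dual) \<Rightarrow>
      'a dual mero \<otimes> ('u \<otimes> 'u) \<Rightarrow> bool"
  where "classical_dynamical_r_matrix \<iota> d x lam r \<longleftrightarrow> YB \<iota> d x lam r = 0"

definition invariant_under :: "'u::complex_algebra_1 set \<Rightarrow> 'v::complex_tvs mero \<otimes> ('u \<otimes> 'u) \<Rightarrow> bool"
  where "invariant_under A r \<longleftrightarrow> (\<forall>y\<in>A. commutator (mero_const (y \<otimes> 1 + 1 \<otimes> y)) r = 0)"


section \<open>Classical dynamical k-matrices\<close>

text \<open>Placements in \<open>A\<^sub>l \<otimes> U \<otimes> U \<otimes> A\<^sub>r\<close>, with positions \<open>0, 1, 2, 0'\<close>. The argument of \<open>cr_kappa1\<close>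
  and \<open>cr_kappa2\<close> lies in \<open>A\<^sub>l \<otimes> U \<otimes> A\<^sub>r\<close>.\<close>

definition cr_pos1 ::
    "'u::complex_algebra_1 \<Rightarrow> 'l::complex_algebra_1 \<otimes> 'u \<otimes> 'u \<otimes> 'r::complex_algebra_1"
  where "cr_pos1 u = 1 \<otimes> u \<otimes> 1 \<otimes> 1"
definition cr_pos2 ::
    "'u::complex_algebra_1 \<Rightarrow> 'l::complex_algebra_1 \<otimes> 'u \<otimes> 'u \<otimes> 'r::complex_algebra_1"
  where "cr_pos2 u = 1 \<otimes> 1 \<otimes> u \<otimes> 1"
definition cr_pos12 ::
    "'u::complex_algebra_1 \<otimes> 'u \<Rightarrow> 'l::complex_algebra_1 \<otimes> 'u \<otimes> 'u \<otimes> 'r::complex_algebra_1"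
  where "cr_pos12 t = 1 \<otimes> tensor_map (\<lambda>a. a) (\<lambda>b. b \<otimes> 1) t"
definition cr_kappa1 ::
    "'l::complex_algebra_1 \<otimes> 'u::complex_algebra_1 \<otimes> 'r::complex_algebra_1 \<Rightarrow> 'l \<otimes> 'u \<otimes> 'u \<otimes> 'r"
  where "cr_kappa1 = tensor_map (\<lambda>a. a) (tensor_map (\<lambda>u. u) (\<lambda>b. 1 \<otimes> b))"
definition cr_kappa2 ::
    "'l::complex_algebra_1 \<otimes> 'u::complex_algebra_1 \<otimes> 'r::complex_algebra_1 \<Rightarrow> 'l \<otimes> 'u \<otimes> 'u \<otimes> 'r"
  where "cr_kappa2 = tensor_map (\<lambda>a. a) (\<lambda>t. 1 \<otimes> t)"

lemma cr_pos_pure: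
  "cr_pos12 (u \<otimes> v) = 1 \<otimes> u \<otimes> v \<otimes> 1"
  "cr_kappa1 (a \<otimes> u \<otimes> b) = a \<otimes> u \<otimes> 1 \<otimes> b"
  "cr_kappa2 (a \<otimes> u \<otimes> b) = a \<otimes> 1 \<otimes> u \<otimes> b"
  unfolding cr_pos12_def cr_kappa1_def cr_kappa2_def
  by (simp_all add: tensor_map_pure clinear_tensor_map clinear_id clinear_tensor_left
      clinear_tensor_right)

definition CR ::
    "('a::complex_vector \<Rightarrow> 'u::complex_algebra_1) \<Rightarrow> nat \<Rightarrow> (nat \<Rightarrow> 'a) \<Rightarrow> (nat \<Rightarrow> 'a dual) \<Rightarrow>
      'a dual mero \<otimes> ('u \<otimes> 'u) \<Rightarrow> 'a dual mero \<otimes> ('u \<otimes> 'u) \<Rightarrow>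
      'a dual mero \<otimes> ('l::complex_algebra_1 \<otimes> 'u \<otimes> 'r::complex_algebra_1) \<Rightarrow>
      'a dual mero \<otimes> ('l \<otimes> 'u \<otimes> 'u \<otimes> 'r)"
  where "CR \<iota> d x lam rp rm \<kappa> =
    (let rp12 = pointwise cr_pos12 rp; rm12 = pointwise cr_pos12 rm;
         \<kappa>1 = pointwise cr_kappa1 \<kappa>; \<kappa>2 = pointwise cr_kappa2 \<kappa>;
         E = mero_E \<iota> d x lam
     in commutator (\<kappa>1 + rm12) (\<kappa>2 + rp12) + E cr_pos2 (rm12 + \<kappa>1) - E cr_pos1 (rp12 + \<kappa>2))"

text \<open>\<open>Al\<close> and \<open>Ar\<close> are unital subalgebras of the ambient algebras \<open>'l\<close> and \<open>'r\<close>. Since tensor products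
  over a field preserve injections, \<open>Al \<otimes> 'u \<otimes> Ar\<close> is a subalgebra of \<open>'l \<otimes> 'u \<otimes> 'r\<close>, and the equation
  \<open>CR = 0\<close> may be read in the ambient algebra.\<close>

definition classical_dynamical_k_matrix ::
    "('a::complex_vector \<Rightarrow> 'u::complex_algebra_1) \<Rightarrow> nat \<Rightarrow> (nat \<Rightarrow> 'a) \<Rightarrow> (nat \<Rightarrow> 'a dual) \<Rightarrow>
      'l::complex_algebra_1 set \<Rightarrow> 'r::complex_algebra_1 set \<Rightarrow>
      'a dual mero \<otimes> ('u \<otimes> 'u) \<Rightarrow> 'a dual mero \<otimes> ('u \<otimes> 'u) \<Rightarrow>
      'a dual mero \<otimes> ('l \<otimes> 'u \<otimes> 'r) \<Rightarrow> bool"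
  where "classical_dynamical_k_matrix \<iota> d x lam Al Ar rp rm \<kappa> \<longleftrightarrow>
    \<kappa> \<in> tensor_subspace UNIV (tensor_subspace Al (tensor_subspace UNIV Ar)) \<and>
    CR \<iota> d x lam rp rm \<kappa> = 0"


section \<open>The k-matrices attached to a twisted symmetric r-matrix\<close>

definition involutive_algebra_automorphism :: "('u::complex_algebra_1 \<Rightarrow> 'u) \<Rightarrow> bool"
  where "involutive_algebra_automorphism \<theta> \<longleftrightarrow>
    unital_algebra_hom \<theta> \<and> bij \<theta> \<and> (\<forall>u. \<theta> (\<theta> u) = u)"

definition r_tilde ::
    "('u::complex_algebra_1 \<Rightarrow> 'u) \<Rightarrow> 'v::complex_tvs mero \<otimes> ('u \<otimes> 'u) \<Rightarrow> 'v mero \<otimes> ('u \<otimes> 'u)"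
  where "r_tilde \<theta> r = pointwise (tensor_map \<theta> (\<lambda>b. b)) r"

definition theta_twisted_symmetric ::
    "('u::complex_algebra_1 \<Rightarrow> 'u) \<Rightarrow> 'v::complex_tvs mero \<otimes> ('u \<otimes> 'u) \<Rightarrow> bool"
  where "theta_twisted_symmetric \<theta> r \<longleftrightarrow> pointwise tensor_flip (r_tilde \<theta> r) = r_tilde \<theta> r"

definition r_plus ::
    "('u::complex_algebra_1 \<Rightarrow> 'u) \<Rightarrow> 'v::complex_tvs mero \<otimes> ('u \<otimes> 'u) \<Rightarrow> 'v mero \<otimes> ('u \<otimes> 'u)"
  where "r_plus \<theta> r = (1/2) *\<^sub>C (r_tilde \<theta> r + r)"

definition r_minus ::
    "('u::complex_algebra_1 \<Rightarrow> 'u) \<Rightarrow> 'v::complex_tvs mero \<otimes> ('u \<otimes> 'u) \<Rightarrow> 'v mero \<otimes> ('u \<otimes> 'u)"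
  where "r_minus \<theta> r = (1/2) *\<^sub>C (r_tilde \<theta> r - r)"

definition kappa_core ::
    "('u::complex_algebra_1 \<Rightarrow> 'u) \<Rightarrow> 'v::complex_tvs mero \<otimes> ('u \<otimes> 'u) \<Rightarrow> 'v mero \<otimes> 'u"
  where "kappa_core \<theta> r = (1/2) *\<^sub>C pointwise (tensor_lift (*)) (r_tilde \<theta> r)"

text \<open>Placements in \<open>U \<otimes> U \<otimes> U\<close>, with positions \<open>0, 1, 0'\<close>.\<close>

definition k_pos1 :: "'u::complex_algebra_1 \<Rightarrow> 'u \<otimes> 'u \<otimes> 'u"
  where "k_pos1 u = 1 \<otimes> u \<otimes> 1"
definition k_pos01 :: "'u::complex_algebra_1 \<otimes> 'u \<Rightarrow> 'u \<otimes> 'u \<otimes> 'u"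
  where "k_pos01 = tensor_map (\<lambda>a. a) (\<lambda>b. b \<otimes> 1)"
definition k_pos0'1 :: "'u::complex_algebra_1 \<otimes> 'u \<Rightarrow> 'u \<otimes> 'u \<otimes> 'u"
  where "k_pos0'1 t = 1 \<otimes> tensor_flip t"

lemma k_pos_pure:
  "k_pos01 (a \<otimes> b) = a \<otimes> b \<otimes> 1"
  "k_pos0'1 (a \<otimes> b) = 1 \<otimes> b \<otimes> a"
  unfolding k_pos01_def k_pos0'1_def
  by (simp_all add: tensor_map_pure tensor_flip_pure clinear_id clinear_tensor_left)

lemma unital_subalgebra_eigenspace:
  assumes "unital_algebra_hom \<theta>"
  shows "unital_subalgebra (eigenspace \<theta> 1)"
  using assms
  by (auto simp: unital_subalgebra_def eigenspace_def unital_algebra_hom_def cv.subspace_def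
      clinear_0 clinear_add clinear_scaleC)

lemma cbilinear_times: "cbilinear ((*) :: 'u::complex_algebra_1 \<Rightarrow> _)"
  by (simp add: cbilinear_def clinear_times_left clinear_times_right)

text \<open>The functions \<open>r_plus\<close> and \<open>r_minus\<close> take values in \<open>U\<^sup>+ \<otimes> U\<close> and \<open>U\<^sup>- \<otimes> U\<close>.\<close>

lemma r_plus_minus_values:
  assumes \<theta>: "involutive_algebra_automorphism \<theta>"
  shows "r_plus \<theta> r \<in> tensor_subspace UNIV (tensor_subspace (eigenspace \<theta> 1) UNIV)"
    and "r_minus \<theta> r \<in> tensor_subspace UNIV (tensor_subspace (eigenspace \<theta> (-1)) UNIV)"
proof -
  have lin: "clinear \<theta>" and inv: "\<theta> (\<theta> u) = u" for u
    using \<theta> by (simp_all add: involutive_algebra_automorphism_def unital_algebra_hom_def)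
  have "(1/2) *\<^sub>C (r_tilde \<theta> r + s *\<^sub>C r) \<in> tensor_subspace UNIV (tensor_subspace (eigenspace \<theta> s) UNIV)"
    if s: "s * s = 1" for s
  proof (induction r rule: tensor_induct)
    case (pure f t)
    have "tensor_map \<theta> (\<lambda>b. b) t + s *\<^sub>C t \<in> tensor_subspace (eigenspace \<theta> s) UNIV"
    proof (induction t rule: tensor_induct)
      case (pure u v)
      have "\<theta> u + s *\<^sub>C u \<in> eigenspace \<theta> s"
        by (simp add: eigenspace_def clinear_add[OF lin] clinear_scaleC[OF lin] inv scaleC_add_right
            scaleC_scaleC s scaleC_one add.commute)
      then have "(\<theta> u + s *\<^sub>C u) \<otimes> v \<in> tensor_subspace (eigenspace \<theta> s) UNIV"
        unfolding tensor_subspace_def by (intro cv.span_base) auto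
      then show ?case
        by (simp add: tensor_map_pure lin clinear_id tensor_bilinear_simps)
    next
      case (add t t')
      from cv.span_add[OF this[unfolded tensor_subspace_def]] show ?case
        unfolding tensor_subspace_def
        by (simp add: clinear_add[OF clinear_tensor_map[OF lin clinear_id]] scaleC_add_right add_ac)
    qed
    then have "f \<otimes> (tensor_map \<theta> (\<lambda>b. b) t + s *\<^sub>C t)
        \<in> tensor_subspace UNIV (tensor_subspace (eigenspace \<theta> s) UNIV)"
      unfolding tensor_subspace_def[of UNIV "tensor_subspace _ _"] by (intro cv.span_base) auto
    then have "(1/2) *\<^sub>C (f \<otimes> (tensor_map \<theta> (\<lambda>b. b) t + s *\<^sub>C t))
        \<in> tensor_subspace UNIV (tensor_subspace (eigenspace \<theta> s) UNIV)"
      unfolding tensor_subspace_def[of UNIV "tensor_subspace _ _"] by (rule cv.span_scale)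
    then show ?case
      by (simp add: r_tilde_def pointwise_def tensor_map_pure clinear_id lin clinear_tensor_map
          tensor_bilinear_simps)
  next
    case (add r r')
    from cv.span_add[OF this[unfolded tensor_subspace_def[of UNIV "tensor_subspace _ _"]]] show ?case
      unfolding tensor_subspace_def[of UNIV "tensor_subspace _ _"]
      by (simp add: r_tilde_def pointwise_def scaleC_add_right add_ac
          clinear_add[OF clinear_tensor_map[OF clinear_id clinear_tensor_map[OF lin clinear_id]]])
  qed
  from this[of 1] this[of "-1"]
  show "r_plus \<theta> r \<in> tensor_subspace UNIV (tensor_subspace (eigenspace \<theta> 1) UNIV)"
    and "r_minus \<theta> r \<in> tensor_subspace UNIV (tensor_subspace (eigenspace \<theta> (-1)) UNIV)"
    by (simp_all add: r_plus_def r_minus_def scaleC_one)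
qed

end

theory Submission
  imports Defs
begin

text \<open>Write \<open>s = r_tilde \<theta> r\<close>, so that \<open>s = r\<^sup>+ + r\<^sup>-\<close> and \<open>r = r\<^sup>+ - r\<^sup>-\<close>. Twisting the dynamical
  Yang--Baxter equation by \<open>\<theta>\<close> and permuting positions replaces some of the \<open>r\<^sub>i\<^sub>j\<close> by \<open>s\<^sub>i\<^sub>j\<close> and, since
  \<open>\<theta> = -1\<close> on \<open>\<aa>\<close>, changes signs of the \<open>E\<^sub>i\<close>.

  The terms of \<open>CR\<close> containing \<open>r\<^sup>+\<^sub>0\<^sub>1\<close> and \<open>r\<^sup>+\<^sub>0\<^sub>2\<close> sum to an average of four such equations; the same holds
  for position \<open>0'\<close>, and mixed terms commute. For the core, combine two pairs of such equations
  so that the terms with \<open>s\<^sub>1\<^sub>2\<close> become \<open>[s\<^sub>1\<^sub>2, r\<^sup>\<plusminus>\<^sub>1\<^sub>3 + r\<^sup>\<plusminus>\<^sub>2\<^sub>3]\<close>, and multiply the first two components. This yields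
  \<open>[\<kappa>\<^sub>1, r\<^sup>+]\<close> and \<open>[\<kappa>\<^sub>2, r\<^sup>-]\<close>, up to correction terms that cancel in \<open>CR\<close>. The multiplication turns
  half of the terms \<open>E\<^sub>i F\<close> into \<open>\<Sum>\<^sub>k \<partial>\<^sub>k F * x\<^sub>k\<close>; \<open>\<aa>\<close>-invariance reconciles the two orders.\<close>

section \<open>Meromorphic functions with values in a tensor product\<close>

lemma add_eq_0: "a = 0 \<Longrightarrow> b = 0 \<Longrightarrow> a + b = 0" for a b :: "'a::comm_monoid_add"
  by simp

text \<open>The factors 1/2 in r^+ and r^- are avoided by proving four times an equation, where
  additive rearrangement suffices; this lemma, used twice, then divides by four.\<close>

lemma double_eq_0D: "x + x = 0 \<Longrightarrow> x = 0" for x :: "'a::complex_vector"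
proof -
  assume "x + x = 0"
  moreover have "x = (1/2) *\<^sub>C (x + x)"
    by (simp flip: scaleC_add_left add: scaleC_add_right scaleC_one)
  ultimately show "x = 0" by simp
qed

lemma tensor_induct2 [case_names pure add]:
  assumes "\<And>f a b. P (f \<otimes> a \<otimes> b)" "\<And>s t. P s \<Longrightarrow> P t \<Longrightarrow> P (s + t)"
  shows "P t"
proof (induction t rule: tensor_induct)
  case (pure f w)
  show ?case
    by (induction w rule: tensor_induct) (simp_all add: assms tensor_add_right)
qed (rule assms)

lemma commutator_bilinear:
  "commutator (a + b) c = commutator a c + commutator b c"
  "commutator (a - b) c = commutator a c - commutator b c"
  "commutator (- a) c = - commutator a c"
  "commutator c (a + b) = commutator c a + commutator c b"
  "commutator c (a - b) = commutator c a - commutator c b"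
  "commutator c (- a) = - commutator c a"
  by (simp_all add: commutator_def algebra_simps)

lemma pointwise_pure: "clinear f \<Longrightarrow> pointwise f (g \<otimes> b) = g \<otimes> f b"
  by (simp add: pointwise_def tensor_map_pure clinear_id)

lemma clinear_pointwise: "clinear f \<Longrightarrow> clinear (pointwise f)"
  by (simp add: pointwise_def clinear_tensor_map clinear_id)

lemma pointwise_pointwise:
  assumes "clinear f" "clinear g"
  shows "pointwise f (pointwise g t) = pointwise (\<lambda>x. f (g x)) t"
  by (rule tensor_eq_clinear)
    (simp_all add: assms clinear_pointwise clinear_compose[of "pointwise f"]
      clinear_compose[of f] pointwise_pure)

lemma pointwise_mult:
  assumes f: "unital_algebra_hom f"
  shows "pointwise f (s * t) = pointwise f s * pointwise f t"
proof -
  have lin: "clinear f" and mult: "f (x * y) = f x * f y" for x y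
    using f by (simp_all add: unital_algebra_hom_def)
  note add = clinear_add[OF clinear_pointwise[OF lin]]
  have "pointwise f ((g \<otimes> a) * t) = pointwise f (g \<otimes> a) * pointwise f t" for g a
    by (induction t rule: tensor_induct)
      (simp_all add: pointwise_pure lin mult tensor_times_pure distrib_left add)
  then show ?thesis
    by (induction s rule: tensor_induct) (simp_all add: distrib_right add)
qed

lemma pointwise_const: "clinear f \<Longrightarrow> pointwise f (mero_const b) = mero_const (f b)"
  by (simp add: mero_const_def pointwise_pure)

lemma clinear_partial: "clinear (mero_partial v)"
  by (simp add: mero_partial_def clinear_tensor_map clinear_mero_dir_deriv clinear_id)

lemma partial_pure: "mero_partial v (f \<otimes> b) = mero_dir_deriv v f \<otimes> b"
  by (simp add: mero_partial_def tensor_map_pure clinear_mero_dir_deriv clinear_id)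

lemma partial_pointwise:
  assumes "clinear f"
  shows "mero_partial v (pointwise f t) = pointwise f (mero_partial v t)"
  by (rule tensor_eq_clinear)
    (simp_all add: assms clinear_pointwise clinear_compose[of "pointwise f"]
      clinear_compose[of "mero_partial v"] clinear_partial pointwise_pure partial_pure)

text \<open>The derivative acts on the meromorphic factor only and a constant multiplies the algebra
  factor only, so no product rule is involved.\<close>

lemma partial_const_mult:
  shows "mero_partial v (mero_const b * t) = mero_const b * mero_partial v t"
    and "mero_partial v (t * mero_const b) = mero_partial v t * mero_const b"
  by (induction t rule: tensor_induct; simp add: mero_const_def partial_pure tensor_times_pure
      distrib_left distrib_right clinear_add[OF clinear_partial])+

lemma clinear_mero_E: "clinear (mero_E \<iota> d x lam \<phi>)"
  unfolding mero_E_def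
  by (rule clinearI) (simp_all add: clinear_add[OF clinear_partial] clinear_scaleC[OF clinear_partial]
      distrib_left mult_scaleC_right sum.distrib cv.scale_sum_right)

lemma mero_E_pointwise:
  assumes "unital_algebra_hom f"
  shows "pointwise f (mero_E \<iota> d x lam \<phi> t) = mero_E \<iota> d x lam (\<lambda>u. f (\<phi> u)) (pointwise f t)"
proof -
  have "clinear f" using assms by (simp add: unital_algebra_hom_def)
  then show ?thesis
    by (simp add: mero_E_def clinear_sum clinear_pointwise pointwise_mult assms pointwise_const
        partial_pointwise)
qed

text \<open>The operator E with the factors x_k on the right. It arises when position 2 is merged
  behind position 1: an x_k from position 2 then stands to the right of what came from position
  1.\<close>

definition mero_E_right ::
    "('a::complex_vector \<Rightarrow> 'u) \<Rightarrow> nat \<Rightarrow> (nat \<Rightarrow> 'a) \<Rightarrow> (nat \<Rightarrow> 'a dual) \<Rightarrow>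
      ('u::complex_algebra_1 \<Rightarrow> 'b::complex_algebra_1) \<Rightarrow>
      'a dual mero \<otimes> 'b \<Rightarrow> 'a dual mero \<otimes> 'b"
  where "mero_E_right \<iota> d x lam \<phi> F =
    (\<Sum>k=1..d. mero_partial (lam k) F * mero_const (\<phi> (\<iota> (x k))))"

lemma clinear_mero_E_right: "clinear (mero_E_right \<iota> d x lam \<phi>)"
  unfolding mero_E_right_def
  by (rule clinearI) (simp_all add: clinear_add[OF clinear_partial] clinear_scaleC[OF clinear_partial]
      distrib_right mult_scaleC_left sum.distrib cv.scale_sum_right)


section \<open>Placing tensors by commuting algebra homomorphisms\<close>

text \<open>Replaces subscripts: for maps \<open>\<phi>\<close>, \<open>\<psi>\<close> into
  positions i and j, the element t_ij is \<open>place \<phi> \<psi> t\<close>. With one homomorphism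
  in both arguments it is multiplication followed by that homomorphism, which is how the core
  enters.\<close>

definition pair ::
    "('a::complex_vector \<Rightarrow> 'c::complex_algebra_1) \<Rightarrow> ('b::complex_vector \<Rightarrow> 'c) \<Rightarrow> 'a \<otimes> 'b \<Rightarrow> 'c"
  where "pair \<phi> \<psi> = tensor_lift (\<lambda>a b. \<phi> a * \<psi> b)"

definition commuting :: "('a \<Rightarrow> 'c::complex_algebra_1) \<Rightarrow> ('b \<Rightarrow> 'c) \<Rightarrow> bool"
  where "commuting \<phi> \<psi> \<longleftrightarrow> (\<forall>a b. \<phi> a * \<psi> b = \<psi> b * \<phi> a)"

abbreviation place where "place \<phi> \<psi> \<equiv> pointwise (pair \<phi> \<psi>)"

lemma unital_algebra_homD:
  assumes "unital_algebra_hom f"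
  shows "clinear f" "f (a * b) = f a * f b" "f 1 = 1"
  using assms by (simp_all add: unital_algebra_hom_def)

lemma unital_algebra_hom_compose:
  "unital_algebra_hom f \<Longrightarrow> unital_algebra_hom g \<Longrightarrow> unital_algebra_hom (\<lambda>x. f (g x))"
  by (simp add: unital_algebra_hom_def clinear_compose)

lemma commutingD: "commuting \<phi> \<psi> \<Longrightarrow> \<phi> a * \<psi> b = \<psi> b * \<phi> a"
  by (simp add: commuting_def)

lemma commuting_sym: "commuting \<phi> \<psi> \<Longrightarrow> commuting \<psi> \<phi>"
  by (simp add: commuting_def)

lemma commuting_compose:
  "commuting \<phi> \<psi> \<Longrightarrow> commuting (\<lambda>a. \<phi> (f a)) \<psi>"
  "commuting \<phi> \<psi> \<Longrightarrow> commuting \<phi> (\<lambda>a. \<psi> (f a))"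
  by (simp_all add: commuting_def)

lemma cbilinear_pair:
  fixes \<phi> :: "'a::complex_vector \<Rightarrow> 'c::complex_algebra_1"
  shows "clinear \<phi> \<Longrightarrow> clinear \<psi> \<Longrightarrow> cbilinear (\<lambda>a b. \<phi> a * \<psi> b)"
  by (rule cbilinearI) (simp_all add: clinear_add clinear_scaleC distrib_left distrib_right
      mult_scaleC_left mult_scaleC_right)

lemma clinear_pair: "clinear \<phi> \<Longrightarrow> clinear \<psi> \<Longrightarrow> clinear (pair \<phi> \<psi>)"
  unfolding pair_def by (intro clinear_tensor_lift cbilinear_pair)

lemma pair_pure: "clinear \<phi> \<Longrightarrow> clinear \<psi> \<Longrightarrow> pair \<phi> \<psi> (a \<otimes> b) = \<phi> a * \<psi> b"
  unfolding pair_def by (rule tensor_lift_pure[OF cbilinear_pair])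

lemma commuting_pair:
  assumes "clinear \<psi>" "clinear \<xi>" "commuting \<phi> \<psi>" "commuting \<phi> \<xi>"
  shows "commuting \<phi> (pair \<psi> \<xi>)"
  unfolding commuting_def
proof (intro allI)
  fix a t
  have "\<phi> a * (\<psi> b * \<xi> c) = \<psi> b * \<xi> c * \<phi> a" for b c
    using commutingD[OF assms(3), of a b] commutingD[OF assms(4), of a c]
    by (metis mult.assoc)
  then show "\<phi> a * pair \<psi> \<xi> t = pair \<psi> \<xi> t * \<phi> a"
    by (induction t rule: tensor_induct)
      (simp_all add: assms pair_pure clinear_add[OF clinear_pair] distrib_left distrib_right)
qed

text \<open>The universal property of the tensor product of algebras: in \<phi>(a) \<psi>(b)
  \<phi>(a') \<psi>(b') commutation moves \<phi>(a') to the left of \<psi>(b).\<close>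

lemma unital_algebra_hom_pair:
  assumes "unital_algebra_hom \<phi>" "unital_algebra_hom \<psi>" "commuting \<phi> \<psi>"
  shows "unital_algebra_hom (pair \<phi> \<psi>)"
proof -
  note lin = unital_algebra_homD(1)[OF assms(1)] unital_algebra_homD(1)[OF assms(2)]
  have pure2: "pair \<phi> \<psi> ((a \<otimes> b) * (a' \<otimes> b')) = \<phi> a * \<psi> b * (\<phi> a' * \<psi> b')" for a b a' b'
    by (simp add: tensor_times_pure pair_pure lin unital_algebra_homD(2)[OF assms(1)]
        unital_algebra_homD(2)[OF assms(2)])
      (metis (no_types) commutingD[OF assms(3), of a' b] mult.assoc)
  have pure1: "pair \<phi> \<psi> ((a \<otimes> b) * t) = \<phi> a * \<psi> b * pair \<phi> \<psi> t" for a b t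
    by (induction t rule: tensor_induct)
      (simp_all add: pure2, simp_all add: pair_pure lin distrib_left clinear_add[OF clinear_pair])
  have "pair \<phi> \<psi> (s * t) = pair \<phi> \<psi> s * pair \<phi> \<psi> t" for s t
    by (induction s rule: tensor_induct)
      (simp_all add: pure1, simp_all add: pair_pure lin distrib_right clinear_add[OF clinear_pair])
  moreover have "pair \<phi> \<psi> 1 = 1"
    by (simp add: one_tensor_def pair_pure lin unital_algebra_homD(3)[OF assms(1)]
        unital_algebra_homD(3)[OF assms(2)])
  ultimately show ?thesis
    by (simp add: unital_algebra_hom_def clinear_pair lin)
qed

lemma place_pure:
  "clinear \<phi> \<Longrightarrow> clinear \<psi> \<Longrightarrow> place \<phi> \<psi> (f \<otimes> a \<otimes> b) = f \<otimes> (\<phi> a * \<psi> b)"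
  by (simp add: pointwise_pure clinear_pair pair_pure)

lemma clinear_place: "clinear \<phi> \<Longrightarrow> clinear \<psi> \<Longrightarrow> clinear (place \<phi> \<psi>)"
  by (intro clinear_pointwise clinear_pair)

text \<open>The meromorphic coefficients lie in a commutative algebra, so it is enough that the
  values commute.\<close>

lemma pointwise_commute:
  assumes "clinear \<phi>" "clinear \<psi>" "commuting \<phi> \<psi>"
  shows "commutator (pointwise \<phi> s) (pointwise \<psi> t) = 0"
proof -
  have "pointwise \<phi> (f \<otimes> a) * pointwise \<psi> t = pointwise \<psi> t * pointwise \<phi> (f \<otimes> a)" for f a
    by (induction t rule: tensor_induct)
      (simp_all add: pointwise_pure assms tensor_times_pure clinear_add[OF clinear_pointwise]
        distrib_left distrib_right mult.commute[of f] commutingD[OF assms(3)])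
  then have "pointwise \<phi> s * pointwise \<psi> t = pointwise \<psi> t * pointwise \<phi> s"
    by (induction s rule: tensor_induct)
      (simp_all add: assms clinear_add[OF clinear_pointwise] distrib_left distrib_right)
  then show ?thesis by (simp add: commutator_def)
qed

text \<open>Since the positions commute, exchanging the components amounts to exchanging the
  positions; this is the rule (t_21)_ij = t_ji.\<close>

lemma place_tensor_flip:
  assumes "clinear \<phi>" "clinear \<psi>" "commuting \<phi> \<psi>"
  shows "place \<phi> \<psi> (pointwise tensor_flip t) = place \<psi> \<phi> t"
  by (induction t rule: tensor_induct2)
    (simp_all add: assms pointwise_pure clinear_tensor_flip tensor_flip_pure clinear_pair
      pair_pure commutingD[OF assms(3)] clinear_add[OF clinear_pointwise])

lemma place_pointwise_left:
  assumes "clinear \<phi>" "clinear \<psi>" "clinear f"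
  shows "place \<phi> \<psi> (pointwise (tensor_map f (\<lambda>b. b)) t) = place (\<lambda>a. \<phi> (f a)) \<psi> t"
  by (induction t rule: tensor_induct2)
    (simp_all add: assms pointwise_pure clinear_tensor_map clinear_id tensor_map_pure clinear_pair
      pair_pure clinear_compose[of \<phi>] clinear_add[OF clinear_pointwise])

lemma commutator_hom:
  "unital_algebra_hom f \<Longrightarrow>
    pointwise f (commutator s t) = commutator (pointwise f s) (pointwise f t)"
  by (simp add: commutator_def clinear_diff[OF clinear_pointwise] unital_algebra_homD(1) pointwise_mult)

lemma pair_yb_pos:
  assumes "unital_algebra_hom \<phi>1" "unital_algebra_hom \<phi>2" "unital_algebra_hom \<phi>3"
  shows "pair \<phi>1 (pair \<phi>2 \<phi>3) (yb_pos1 u) = \<phi>1 u"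
    and "pair \<phi>1 (pair \<phi>2 \<phi>3) (yb_pos2 u) = \<phi>2 u"
    and "pair \<phi>1 (pair \<phi>2 \<phi>3) (yb_pos3 u) = \<phi>3 u"
  by (simp_all add: yb_pos1_def yb_pos2_def yb_pos3_def pair_pure clinear_pair
      assms[THEN unital_algebra_homD(1)] assms[THEN unital_algebra_homD(3)])

lemma clinear_yb_pos_pair: "clinear yb_pos12" "clinear yb_pos13" "clinear yb_pos23"
  unfolding yb_pos12_def yb_pos13_def yb_pos23_def
  by (intro clinear_tensor_map clinear_id clinear_tensor_left clinear_tensor_right)+

lemma place_yb_pos:
  assumes "unital_algebra_hom \<phi>1" "unital_algebra_hom \<phi>2" "unital_algebra_hom \<phi>3"
  shows "pointwise (pair \<phi>1 (pair \<phi>2 \<phi>3)) (pointwise yb_pos12 t) = place \<phi>1 \<phi>2 t"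
    and "pointwise (pair \<phi>1 (pair \<phi>2 \<phi>3)) (pointwise yb_pos13 t) = place \<phi>1 \<phi>3 t"
    and "pointwise (pair \<phi>1 (pair \<phi>2 \<phi>3)) (pointwise yb_pos23 t) = place \<phi>2 \<phi>3 t"
  by (induction t rule: tensor_induct2; simp add: pointwise_pure clinear_yb_pos_pair
      yb_pos_pure clinear_pair pair_pure clinear_add[OF clinear_pointwise]
      assms[THEN unital_algebra_homD(1)] assms[THEN unital_algebra_homD(3)])+

text \<open>The dynamical Yang--Baxter equation may be read in any algebra into which \<open>U\<close> is mapped by three
  commuting homomorphisms; this covers all permutations of the tensor positions and all twists by
  \<open>\<theta>\<close> at once.\<close>

lemma YB_place:
  assumes hom: "unital_algebra_hom \<phi>1" "unital_algebra_hom \<phi>2" "unital_algebra_hom \<phi>3"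
    and com: "commuting \<phi>1 \<phi>2" "commuting \<phi>1 \<phi>3" "commuting \<phi>2 \<phi>3"
    and r: "classical_dynamical_r_matrix \<iota> d x lam r"
  shows "commutator (place \<phi>1 \<phi>2 r) (place \<phi>1 \<phi>3 r)
      + commutator (place \<phi>1 \<phi>2 r) (place \<phi>2 \<phi>3 r)
      + commutator (place \<phi>1 \<phi>3 r) (place \<phi>2 \<phi>3 r)
      + mero_E \<iota> d x lam \<phi>1 (place \<phi>2 \<phi>3 r) - mero_E \<iota> d x lam \<phi>2 (place \<phi>1 \<phi>3 r)
      + mero_E \<iota> d x lam \<phi>3 (place \<phi>1 \<phi>2 r) = 0"
proof -
  let ?f = "pair \<phi>1 (pair \<phi>2 \<phi>3)"
  have f: "unital_algebra_hom ?f"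
    by (intro unital_algebra_hom_pair hom com commuting_pair hom[THEN unital_algebra_homD(1)])
  note lin = clinear_pointwise[OF unital_algebra_homD(1)[OF f]]
  have "pointwise ?f (YB \<iota> d x lam r) = 0"
    using r by (simp add: classical_dynamical_r_matrix_def clinear_0[OF lin])
  then show ?thesis
    by (simp add: YB_def Let_def clinear_add[OF lin] clinear_diff[OF lin] commutator_hom[OF f]
        mero_E_pointwise[OF f] place_yb_pos[OF hom] pair_yb_pos[OF hom])
qed

section \<open>Twisted symmetric r-matrices\<close>

lemma mero_E_minus:
  assumes "\<And>k. \<phi> (\<iota> (x k)) = - \<psi> (\<iota> (x k))"
  shows "mero_E \<iota> d x lam \<phi> F = - mero_E \<iota> d x lam \<psi> F"
  by (simp add: mero_E_def assms mero_const_def clinear_minus[OF clinear_tensor_right] sum_negf)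

locale twisted_r_matrix =
  fixes \<theta> :: "'u::complex_algebra_1 \<Rightarrow> 'u"
    and \<iota> :: "'a::complex_vector \<Rightarrow> 'u"
    and d :: nat and x :: "nat \<Rightarrow> 'a" and lam :: "nat \<Rightarrow> 'a dual"
    and r :: "'a dual mero \<otimes> ('u \<otimes> 'u)"
  assumes involutive: "involutive_algebra_automorphism \<theta>"
    and anti_invariant: "\<theta> (\<iota> v) = - \<iota> v"
    and twisted_symmetric: "theta_twisted_symmetric \<theta> r"
    and invariant: "invariant_under (range \<iota>) r"
    and r_matrix: "classical_dynamical_r_matrix \<iota> d x lam r"
begin

abbreviation "s \<equiv> r_tilde \<theta> r"
abbreviation "E \<equiv> mero_E \<iota> d x lam"
abbreviation "E' \<equiv> mero_E_right \<iota> d x lam"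

lemma hom_theta: "unital_algebra_hom \<theta>" and theta_theta: "\<theta> (\<theta> u) = u"
  using involutive by (simp_all add: involutive_algebra_automorphism_def)

lemmas clinear_theta = unital_algebra_homD(1)[OF hom_theta]

lemma E_arith:
  "E \<phi> (F + G) = E \<phi> F + E \<phi> G" "E \<phi> (F - G) = E \<phi> F - E \<phi> G" "E \<phi> (- F) = - E \<phi> F"
  "E' \<phi> (F + G) = E' \<phi> F + E' \<phi> G" "E' \<phi> (F - G) = E' \<phi> F - E' \<phi> G" "E' \<phi> (- F) = - E' \<phi> F"
  by (simp_all add: clinear_add clinear_diff clinear_minus clinear_mero_E clinear_mero_E_right)

lemma E_theta:
  assumes "unital_algebra_hom \<phi>"
  shows "E (\<lambda>u. \<phi> (\<theta> u)) F = - E \<phi> F"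
  by (rule mero_E_minus) (simp add: anti_invariant clinear_minus unital_algebra_homD(1)[OF assms])

lemma place_theta_r:
  assumes "clinear \<phi>" "clinear \<psi>"
  shows "place (\<lambda>u. \<phi> (\<theta> u)) \<psi> r = place \<phi> \<psi> s"
  by (simp add: r_tilde_def place_pointwise_left assms clinear_theta)

lemma place_theta_s:
  assumes "clinear \<phi>" "clinear \<psi>"
  shows "place (\<lambda>u. \<phi> (\<theta> u)) \<psi> s = place \<phi> \<psi> r"
proof -
  have "clinear (\<lambda>u. \<phi> (\<theta> u))"
    by (rule clinear_compose[OF assms(1) clinear_theta])
  then show ?thesis
    using place_pointwise_left[OF _ assms(2) clinear_theta, of "\<lambda>u. \<phi> (\<theta> u)" r]
    by (simp add: r_tilde_def theta_theta)
qed

lemma place_s_sym: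
  assumes "clinear \<phi>" "clinear \<psi>" "commuting \<phi> \<psi>"
  shows "place \<psi> \<phi> s = place \<phi> \<psi> s"
  using twisted_symmetric
  by (simp add: theta_twisted_symmetric_def flip: place_tensor_flip[OF assms])

text \<open>This is (\<theta> \<otimes> \<theta>) r = r_21. The first twist turns r into the
  symmetric s; after exchanging its positions, the second twist sits in the first slot and turns s
  back into r, because \<theta> is an involution.\<close>

lemma place_theta_theta_r:
  assumes "clinear \<phi>" "clinear \<psi>" "commuting \<phi> \<psi>"
  shows "place (\<lambda>u. \<phi> (\<theta> u)) (\<lambda>u. \<psi> (\<theta> u)) r = place \<psi> \<phi> r"
proof -
  have lin: "clinear (\<lambda>u. \<psi> (\<theta> u))"
    by (rule clinear_compose[OF assms(2) clinear_theta])
  have com: "commuting \<phi> (\<lambda>u. \<psi> (\<theta> u))"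
    by (rule commuting_compose(2)[OF assms(3)])
  have "place (\<lambda>u. \<phi> (\<theta> u)) (\<lambda>u. \<psi> (\<theta> u)) r = place \<phi> (\<lambda>u. \<psi> (\<theta> u)) s"
    by (rule place_theta_r[OF assms(1) lin])
  also have "\<dots> = place (\<lambda>u. \<psi> (\<theta> u)) \<phi> s"
    by (rule place_s_sym[OF assms(1) lin com, symmetric])
  also have "\<dots> = place \<psi> \<phi> r"
    by (rule place_theta_s[OF assms(2,1)])
  finally show ?thesis .
qed

lemma r_plus_minus: "s = r_plus \<theta> r + r_minus \<theta> r" "r = r_plus \<theta> r - r_minus \<theta> r"
proof -
  have half: "(1/2) *\<^sub>C t + (1/2) *\<^sub>C t = t" for t :: "'a dual mero \<otimes> ('u \<otimes> 'u)"
    by (simp flip: scaleC_add_left add: scaleC_one)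
  have "r_plus \<theta> r + r_minus \<theta> r = (1/2) *\<^sub>C s + (1/2) *\<^sub>C s"
    by (simp add: r_plus_def r_minus_def scaleC_add_right cv.scale_right_diff_distrib)
  then show "s = r_plus \<theta> r + r_minus \<theta> r" by (simp add: half)
  have "r_plus \<theta> r - r_minus \<theta> r = (1/2) *\<^sub>C r + (1/2) *\<^sub>C r"
    by (simp add: r_plus_def r_minus_def scaleC_add_right cv.scale_right_diff_distrib)
  then show "r = r_plus \<theta> r - r_minus \<theta> r" by (simp add: half)
qed

lemma place_plus_minus:
  assumes "clinear \<phi>" "clinear \<psi>"
  shows "place \<phi> \<psi> s = place \<phi> \<psi> (r_plus \<theta> r) + place \<phi> \<psi> (r_minus \<theta> r)"
    and "place \<phi> \<psi> r = place \<phi> \<psi> (r_plus \<theta> r) - place \<phi> \<psi> (r_minus \<theta> r)"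
  by (subst r_plus_minus(1), simp only: clinear_add[OF clinear_place[OF assms]])
    (subst r_plus_minus(2), simp only: clinear_diff[OF clinear_place[OF assms]])

text \<open>\<open>YB_place\<close> with \<theta> inserted in position 1: the two r with first slot
  in position 1 become s, r_23 stays, and E_1 changes sign because \<theta> = -1 on the x_k.\<close>

lemma YB_twisted:
  assumes hom: "unital_algebra_hom \<phi>1" "unital_algebra_hom \<phi>2" "unital_algebra_hom \<phi>3"
    and com: "commuting \<phi>1 \<phi>2" "commuting \<phi>1 \<phi>3" "commuting \<phi>2 \<phi>3"
  shows "commutator (place \<phi>1 \<phi>2 s) (place \<phi>1 \<phi>3 s)
      + commutator (place \<phi>1 \<phi>2 s) (place \<phi>2 \<phi>3 r)
      + commutator (place \<phi>1 \<phi>3 s) (place \<phi>2 \<phi>3 r)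
      - E \<phi>1 (place \<phi>2 \<phi>3 r) - E \<phi>2 (place \<phi>1 \<phi>3 s) + E \<phi>3 (place \<phi>1 \<phi>2 s) = 0"
  using YB_place[OF unital_algebra_hom_compose[OF hom(1) hom_theta] hom(2,3)
      commuting_compose(1)[OF com(1)] commuting_compose(1)[OF com(2)] com(3) r_matrix]
  by (simp add: place_theta_r E_theta[OF hom(1)] hom[THEN unital_algebra_homD(1)])

text \<open>Four times the left hand side is the sum of four Yang--Baxter equations: positions in the order
  0, 1, 2, untwisted and twisted in 0, and in the order 1, 0, 2, twisted in 1 and twisted in both
  1 and 0.\<close>

lemma mixed_YB:
  assumes hom: "unital_algebra_hom \<phi>0" "unital_algebra_hom \<phi>1" "unital_algebra_hom \<phi>2"
    and com: "commuting \<phi>0 \<phi>1" "commuting \<phi>0 \<phi>2" "commuting \<phi>1 \<phi>2"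
  shows "commutator (place \<phi>0 \<phi>1 (r_plus \<theta> r)) (place \<phi>0 \<phi>2 (r_plus \<theta> r))
      + commutator (place \<phi>0 \<phi>1 (r_plus \<theta> r)) (place \<phi>1 \<phi>2 (r_plus \<theta> r))
      + commutator (place \<phi>1 \<phi>2 (r_minus \<theta> r)) (place \<phi>0 \<phi>2 (r_plus \<theta> r))
      + E \<phi>2 (place \<phi>0 \<phi>1 (r_plus \<theta> r)) - E \<phi>1 (place \<phi>0 \<phi>2 (r_plus \<theta> r)) = 0"
    (is "?X = 0")
proof -
  note lin = hom[THEN unital_algebra_homD(1)]
  let ?\<phi>0' = "\<lambda>u. \<phi>0 (\<theta> u)"
  have hom0': "unital_algebra_hom ?\<phi>0'"
    by (rule unital_algebra_hom_compose[OF hom(1) hom_theta])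
  note lin0' = unital_algebra_homD(1)[OF hom0']
  \<comment> \<open>Here s is r twisted in position 1, and position 0 is twisted already, so both
    slots of r carry \<theta>, which flips r.\<close>
  have r10: "place \<phi>1 ?\<phi>0' s = place \<phi>0 \<phi>1 r"
    using place_theta_theta_r[OF lin(2,1) commuting_sym[OF com(1)]]
      place_theta_r[OF lin(2) lin0'] by simp
  have s10: "place \<phi>1 \<phi>0 s = place \<phi>0 \<phi>1 s"
    by (rule place_s_sym[OF lin(1,2) com(1)])
  note pm = place_plus_minus[OF lin(1,2)] place_plus_minus[OF lin(1,3)] place_plus_minus[OF lin(2,3)]
    commutator_bilinear E_arith
  note eqs = YB_place[OF hom com r_matrix, unfolded pm]
    YB_twisted[OF hom com, unfolded pm]
    YB_twisted[OF hom(2,1,3) commuting_sym[OF com(1)] com(3,2), unfolded s10 pm]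
    YB_twisted[OF hom(2) hom0' hom(3) commuting_sym[OF commuting_compose(1)[OF com(1)]] com(3)
        commuting_compose(1)[OF com(2)],
      unfolded E_theta[OF hom(1)] place_theta_r[OF lin(1,3)] r10 pm]
  \<comment> \<open>The terms with E_0 cancel in two pairs. The rest groups into products of the
    sums r + s = 2 r^+ and the difference s - r = 2 r^-.\<close>
  have "(?X + ?X) + (?X + ?X) = 0"
    using add_eq_0[OF add_eq_0[OF eqs(1,2)] add_eq_0[OF eqs(3,4)]]
    by (simp add: commutator_bilinear commutator_def algebra_simps)
  then show ?thesis by (blast dest: double_eq_0D)
qed

end

section \<open>Contracting two tensor positions\<close>

lemma clinear_yb_pos: "clinear yb_pos1" "clinear yb_pos2" "clinear yb_pos3"
  by (simp_all add: clinear_iff yb_pos1_def yb_pos2_def yb_pos3_def tensor_bilinear_simps)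

lemma unital_algebra_hom_yb_pos:
  "unital_algebra_hom yb_pos1" "unital_algebra_hom yb_pos2" "unital_algebra_hom yb_pos3"
  by (simp_all add: unital_algebra_hom_def clinear_yb_pos)
    (simp_all add: yb_pos1_def yb_pos2_def yb_pos3_def tensor_times_pure one_tensor_def)

lemma commuting_yb_pos:
  "commuting yb_pos1 yb_pos2" "commuting yb_pos1 yb_pos3" "commuting yb_pos2 yb_pos3"
  by (simp_all add: commuting_def yb_pos1_def yb_pos2_def yb_pos3_def tensor_times_pure)

text \<open>These are the placements of \<open>YB\<close>, written with \<open>place\<close> so that
  the twisted equations can be stated inside the threefold tensor product before two positions are
  contracted.\<close>

abbreviation "pos12 \<equiv> place yb_pos1 yb_pos2"
abbreviation "pos13 \<equiv> place yb_pos1 yb_pos3"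
abbreviation "pos23 \<equiv> place yb_pos2 yb_pos3"

text \<open>The map \<open>a \<otimes> b \<otimes> c \<mapsto> \<psi> (a * b) * \<xi> c\<close>. It is not multiplicative; what takes the place of
  multiplicativity is the equivariance of the multiplication map under the adjoint action, which
  is \<open>contract_commutator\<close>.\<close>

definition contract ::
    "('u::complex_algebra_1 \<Rightarrow> 'b::complex_algebra_1) \<Rightarrow> ('u \<Rightarrow> 'b) \<Rightarrow>
      'v::complex_tvs mero \<otimes> ('u \<otimes> 'u \<otimes> 'u) \<Rightarrow> 'v mero \<otimes> 'b"
  where "contract \<psi> \<xi> = place \<psi> (pair \<psi> \<xi>)"

text \<open>On pure tensors a \<otimes> b and a' \<otimes> b' this is \<psi>(a a') \<xi>(b' b),
  whereas the product of the two placements is \<psi>(a a') \<xi>(b b'). It records how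
  \<open>contract\<close> fails to be multiplicative.\<close>

definition cross ::
    "('u::complex_algebra_1 \<Rightarrow> 'b::complex_algebra_1) \<Rightarrow> ('u \<Rightarrow> 'b) \<Rightarrow>
      'v::complex_tvs mero \<otimes> ('u \<otimes> 'u) \<Rightarrow> 'v mero \<otimes> ('u \<otimes> 'u) \<Rightarrow> 'v mero \<otimes> 'b"
  where "cross \<psi> \<xi> s t = contract \<psi> \<xi> (pos23 t * pos13 s)"

lemma place_yb_pos_pure:
  "pos12 (f \<otimes> a \<otimes> b) = f \<otimes> a \<otimes> b \<otimes> 1"
  "pos13 (f \<otimes> a \<otimes> b) = f \<otimes> a \<otimes> 1 \<otimes> b"
  "pos23 (f \<otimes> a \<otimes> b) = f \<otimes> 1 \<otimes> a \<otimes> b"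
  by (simp_all add: place_pure clinear_yb_pos)
    (simp_all add: yb_pos1_def yb_pos2_def yb_pos3_def tensor_times_pure)

context
  fixes \<psi> \<xi> :: "'u::complex_algebra_1 \<Rightarrow> 'b::complex_algebra_1"
  assumes hom: "unital_algebra_hom \<psi>" "unital_algebra_hom \<xi>"
    and com: "commuting \<psi> \<xi>"
begin

lemma clinear_contract: "clinear (contract \<psi> \<xi>)"
  unfolding contract_def by (intro clinear_place clinear_pair hom[THEN unital_algebra_homD(1)])

lemma contract_pure: "contract \<psi> \<xi> (f \<otimes> a \<otimes> b \<otimes> c) = f \<otimes> (\<psi> a * (\<psi> b * \<xi> c))"
  by (simp add: contract_def pointwise_pure pair_pure clinear_pair hom[THEN unital_algebra_homD(1)])

lemma xi_psi: "\<xi> b * \<psi> a = \<psi> a * \<xi> b" "\<xi> b * (\<psi> a * w) = \<psi> a * (\<xi> b * w)"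
  by (metis commutingD[OF com]) (metis commutingD[OF com] mult.assoc)

lemmas contract_additive =
  clinear_add[OF clinear_contract] clinear_diff[OF clinear_contract]
  clinear_add[OF clinear_place[OF clinear_yb_pos(1,2)]]
  clinear_add[OF clinear_place[OF clinear_yb_pos(1,3)]]
  clinear_add[OF clinear_place[OF clinear_yb_pos(2,3)]]
  clinear_add[OF clinear_place[OF hom(1,1)[THEN unital_algebra_homD(1)]]]
  clinear_add[OF clinear_place[OF hom[THEN unital_algebra_homD(1)]]]

lemmas contract_simps =
  place_yb_pos_pure tensor_times_pure contract_pure
  place_pure[OF hom(1,1)[THEN unital_algebra_homD(1)]]
  place_pure[OF hom[THEN unital_algebra_homD(1)]]
  hom[THEN unital_algebra_homD(2)] hom[THEN unital_algebra_homD(3)] mult.assoc xi_psi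

lemma contract_commutator:
  "contract \<psi> \<xi> (commutator (pos12 s) (pos13 t + pos23 t)) = commutator (place \<psi> \<psi> s) (place \<psi> \<xi> t)"
proof -
  have "contract \<psi> \<xi> (commutator (pos12 (f \<otimes> a \<otimes> b)) (pos13 t + pos23 t))
      = commutator (place \<psi> \<psi> (f \<otimes> a \<otimes> b)) (place \<psi> \<xi> t)" for f a b
  proof (induction t rule: tensor_induct2)
    case (pure g a' b')
    \<comment> \<open>Of the four products, the two in which a' ends up between a and b cancel; a b
      a' and a' a b remain and form the commutator of a b with a'.\<close>
    show ?case
      by (simp add: commutator_bilinear contract_additive)
        (simp add: commutator_def contract_additive contract_simps mult.commute[of g f])
  next
    case (add t t')
    show ?case by (simp add: commutator_bilinear contract_additive add[symmetric] add_ac)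
  qed
  then show ?thesis
  proof (induction s rule: tensor_induct2)
    case (add s s')
    show ?case
      by (simp add: commutator_bilinear contract_additive
          add(1)[symmetric, OF add(3)] add(2)[symmetric, OF add(3)] add_ac)
  qed
qed

lemma cross_pure:
  "cross \<psi> \<xi> (f \<otimes> a \<otimes> b) (g \<otimes> a' \<otimes> b') = (f * g) \<otimes> (\<psi> a * (\<psi> a' * (\<xi> b' * \<xi> b)))"
  by (simp add: cross_def contract_simps mult.commute)

lemma cross_add:
  "cross \<psi> \<xi> (s + s') t = cross \<psi> \<xi> s t + cross \<psi> \<xi> s' t"
  "cross \<psi> \<xi> s (t + t') = cross \<psi> \<xi> s t + cross \<psi> \<xi> s t'"
  by (simp_all add: cross_def contract_additive distrib_left distrib_right)

text \<open>A product with position 13 on the left, such as s_13 t_23, contracts to the product of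
  the placements; the opposite order gives \<open>cross\<close>. In the sum of both commutators the
  genuine products form a commutator.\<close>

lemma contract_commutator_cross:
  "contract \<psi> \<xi> (commutator (pos13 s) (pos23 t)) + contract \<psi> \<xi> (commutator (pos23 s) (pos13 t))
    = commutator (place \<psi> \<xi> s) (place \<psi> \<xi> t) + cross \<psi> \<xi> t s - cross \<psi> \<xi> s t"
proof -
  have mult: "contract \<psi> \<xi> (pos13 s * pos23 t) = place \<psi> \<xi> s * place \<psi> \<xi> t" for s t :: "'v::complex_tvs mero \<otimes> ('u \<otimes> 'u)"
  proof -
    have "contract \<psi> \<xi> (pos13 (f \<otimes> a \<otimes> b) * pos23 t) = place \<psi> \<xi> (f \<otimes> a \<otimes> b) * place \<psi> \<xi> t"
      for f a b
      by (induction t rule: tensor_induct2)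
        (simp_all add: contract_simps, simp_all add: contract_additive distrib_left)
    then show ?thesis
      by (induction s rule: tensor_induct2)
        (simp_all add: contract_additive distrib_right)
  qed
  show ?thesis
    by (simp add: commutator_def contract_additive mult cross_def)
qed

lemma contract_const_mult:
  "contract \<psi> \<xi> (mero_const (yb_pos3 y) * pos12 t) = mero_const (\<xi> y) * place \<psi> \<psi> t"
  "contract \<psi> \<xi> (mero_const (yb_pos1 y) * pos23 t) = mero_const (\<psi> y) * place \<psi> \<xi> t"
  "contract \<psi> \<xi> (mero_const (yb_pos2 y) * pos13 t) = place \<psi> \<xi> t * mero_const (\<psi> y)"
proof -
  note defs = mero_const_def yb_pos1_def[of y] yb_pos2_def[of y] yb_pos3_def[of y]
  show "contract \<psi> \<xi> (mero_const (yb_pos3 y) * pos12 t) = mero_const (\<xi> y) * place \<psi> \<psi> t"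
    unfolding defs by (induction t rule: tensor_induct2)
      (simp_all add: contract_simps, simp_all add: contract_additive distrib_left)
  show "contract \<psi> \<xi> (mero_const (yb_pos1 y) * pos23 t) = mero_const (\<psi> y) * place \<psi> \<xi> t"
    unfolding defs by (induction t rule: tensor_induct2)
      (simp_all add: contract_simps, simp_all add: contract_additive distrib_left)
  show "contract \<psi> \<xi> (mero_const (yb_pos2 y) * pos13 t) = place \<psi> \<xi> t * mero_const (\<psi> y)"
    unfolding defs by (induction t rule: tensor_induct2)
      (simp_all add: contract_simps, simp_all add: contract_additive distrib_left distrib_right)
qed

lemma contract_E:
  "contract \<psi> \<xi> (mero_E \<iota> d x lam yb_pos3 (pos12 t)) = mero_E \<iota> d x lam \<xi> (place \<psi> \<psi> t)"
  "contract \<psi> \<xi> (mero_E \<iota> d x lam yb_pos1 (pos23 t)) = mero_E \<iota> d x lam \<psi> (place \<psi> \<xi> t)"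
  "contract \<psi> \<xi> (mero_E \<iota> d x lam yb_pos2 (pos13 t)) = mero_E_right \<iota> d x lam \<psi> (place \<psi> \<xi> t)"
  by (simp_all add: mero_E_def mero_E_right_def clinear_sum[OF clinear_contract] partial_pointwise
      clinear_pair clinear_yb_pos hom[THEN unital_algebra_homD(1)] contract_const_mult)

end

text \<open>In \<open>cross\<close> the \<psi> factors follow the order of the arguments and the
  \<xi> factors the reverse order, so exchanging components also exchanges the arguments.\<close>

lemma cross_tensor_flip:
  assumes hom: "unital_algebra_hom \<psi>" "unital_algebra_hom \<xi>" and com: "commuting \<psi> \<xi>"
  shows "cross \<psi> \<xi> (pointwise tensor_flip s) (pointwise tensor_flip t) = cross \<xi> \<psi> t s"
proof -
  note com' = commuting_sym[OF com]
  note add = cross_add[OF hom com] cross_add[OF hom(2,1) com'] clinear_add[OF clinear_pointwise[OF clinear_tensor_flip]]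
  note pure = cross_pure[OF hom com] cross_pure[OF hom(2,1) com']
    pointwise_pure[OF clinear_tensor_flip] tensor_flip_pure
  have eq: "\<psi> a * (\<psi> b * (\<xi> p * \<xi> q)) = \<xi> p * (\<xi> q * (\<psi> a * \<psi> b))" for a b p q
  proof -
    have "\<psi> (a * b) * \<xi> (p * q) = \<xi> (p * q) * \<psi> (a * b)"
      by (rule commutingD[OF com])
    then show ?thesis
      by (simp add: hom[THEN unital_algebra_homD(2)] mult.assoc)
  qed
  have "cross \<psi> \<xi> (pointwise tensor_flip (f \<otimes> a \<otimes> b)) (pointwise tensor_flip t) = cross \<xi> \<psi> t (f \<otimes> a \<otimes> b)" for f a b
    by (induction t rule: tensor_induct2) (simp_all add: add, simp_all add: pure eq mult.commute)
  then show ?thesis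
    by (induction s rule: tensor_induct2) (simp_all add: add)
qed

section \<open>Contracted Yang-Baxter equations and the equation for the core\<close>

context twisted_r_matrix
begin

text \<open>Twisted equations for the orders 1,2,3 and 2,1,3 are added. By symmetry of s, the
  element s_12 then meets only sums t_13 + t_23, as \<open>contract_commutator\<close> requires. As
  s + r = 2 r^+, this produces the commutator of \<kappa>_1 with r^+.\<close>

lemma contract_YB_plus:
  assumes hom: "unital_algebra_hom \<psi>" "unital_algebra_hom \<xi>" and com: "commuting \<psi> \<xi>"
  shows "commutator (place \<psi> \<psi> s) (place \<psi> \<xi> s) + commutator (place \<psi> \<psi> s) (place \<psi> \<xi> r)
      + (commutator (place \<psi> \<xi> s) (place \<psi> \<xi> r) + cross \<psi> \<xi> r s - cross \<psi> \<xi> s r)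
      - E \<psi> (place \<psi> \<xi> r) - E' \<psi> (place \<psi> \<xi> s) - E' \<psi> (place \<psi> \<xi> r) - E \<psi> (place \<psi> \<xi> s)
      + (E \<xi> (place \<psi> \<psi> s) + E \<xi> (place \<psi> \<psi> s)) = 0"
proof -
  note homs = unital_algebra_hom_yb_pos and coms = commuting_yb_pos
  note sym = place_s_sym[OF clinear_yb_pos(1,2) coms(1)]
  note C = contract_commutator[OF hom com] contract_commutator_cross[OF hom com]
    contract_E[OF hom com]
    clinear_add[OF clinear_contract[OF hom com]] clinear_diff[OF clinear_contract[OF hom com]]
  have "commutator (pos12 s) (pos13 s + pos23 s) + commutator (pos12 s) (pos13 r + pos23 r)
      + (commutator (pos13 s) (pos23 r) + commutator (pos23 s) (pos13 r))
      - E yb_pos1 (pos23 r) - E yb_pos2 (pos13 s) - E yb_pos2 (pos13 r) - E yb_pos1 (pos23 s)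
      + (E yb_pos3 (pos12 s) + E yb_pos3 (pos12 s)) = 0"
    using add_eq_0[OF YB_twisted[OF homs coms]
        YB_twisted[OF homs(2,1,3) commuting_sym[OF coms(1)] coms(3,2), unfolded sym]]
    by (simp add: commutator_bilinear algebra_simps)
  from arg_cong[OF this, of "contract \<psi> \<xi>"] show ?thesis
    unfolding C clinear_0[OF clinear_contract[OF hom com]] .
qed

text \<open>The counterpart for \<kappa>_2, from the orders 1,3,2 and 2,3,1, with positions 1 and 2
  merged into \<xi> and position 3 sent to \<psi>. Now s_12 meets r - s = -2 r^-, up to the flip of
  r.\<close>

lemma contract_YB_minus:
  assumes hom: "unital_algebra_hom \<psi>" "unital_algebra_hom \<xi>" and com: "commuting \<psi> \<xi>"
  shows "commutator (place \<xi> \<xi> s) (place \<psi> \<xi> r) - commutator (place \<xi> \<xi> s) (place \<psi> \<xi> s)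
      + (commutator (place \<psi> \<xi> s) (place \<psi> \<xi> r) + cross \<psi> \<xi> s r - cross \<psi> \<xi> r s)
      - E \<xi> (place \<psi> \<xi> r) - E' \<xi> (place \<psi> \<xi> r) + E' \<xi> (place \<psi> \<xi> s) + E \<xi> (place \<psi> \<xi> s)
      - (E \<psi> (place \<xi> \<xi> s) + E \<psi> (place \<xi> \<xi> s)) = 0"
proof -
  note homs = unital_algebra_hom_yb_pos and coms = commuting_yb_pos
  note com' = commuting_sym[OF com]
  note lin = hom[THEN unital_algebra_homD(1)]
  let ?t = "pointwise tensor_flip r"
  note flips = place_s_sym[OF clinear_yb_pos(1,2) coms(1)]
    place_s_sym[OF clinear_yb_pos(2,3) coms(3)]
    place_tensor_flip[OF clinear_yb_pos(1,3) coms(2), symmetric]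
    place_tensor_flip[OF clinear_yb_pos(2,3) coms(3), symmetric]
  note C = contract_commutator[OF hom(2,1) com'] contract_commutator_cross[OF hom(2,1) com']
    contract_E[OF hom(2,1) com']
    clinear_add[OF clinear_contract[OF hom(2,1) com']] clinear_diff[OF clinear_contract[OF hom(2,1) com']]
  have s: "pointwise tensor_flip s = s"
    using twisted_symmetric by (simp add: theta_twisted_symmetric_def)
  \<comment> \<open>In this form the correction terms are opposite to those of
    \<open>contract_YB_plus\<close>.\<close>
  have cross: "cross \<xi> \<psi> ?t s = cross \<psi> \<xi> s r" "cross \<xi> \<psi> s ?t = cross \<psi> \<xi> r s"
    using cross_tensor_flip[OF hom(2,1) com', of r s] cross_tensor_flip[OF hom(2,1) com', of s r]
    by (simp_all add: s)
  have "commutator (pos12 s) (pos13 ?t + pos23 ?t) - commutator (pos12 s) (pos13 s + pos23 s)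
      + (commutator (pos13 s) (pos23 ?t) + commutator (pos23 s) (pos13 ?t))
      - E yb_pos1 (pos23 ?t) - E yb_pos2 (pos13 ?t) + E yb_pos2 (pos13 s) + E yb_pos1 (pos23 s)
      - (E yb_pos3 (pos12 s) + E yb_pos3 (pos12 s)) = 0"
    using add_eq_0[OF
        YB_twisted[OF homs(1,3,2) coms(2,1) commuting_sym[OF coms(3)], unfolded flips]
        YB_twisted[OF homs(2,3,1) coms(3) commuting_sym[OF coms(1)] commuting_sym[OF coms(2)],
          unfolded flips]]
    by (simp add: commutator_bilinear commutator_def algebra_simps)
  from arg_cong[OF this, of "contract \<xi> \<psi>"] show ?thesis
    unfolding C clinear_0[OF clinear_contract[OF hom(2,1) com']] cross
      place_s_sym[OF lin com] place_tensor_flip[OF lin(2,1) com'] .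
qed

lemma commutator_place_r:
  assumes hom: "unital_algebra_hom \<psi>" "unital_algebra_hom \<xi>" and com: "commuting \<psi> \<xi>"
  shows "commutator (mero_const (\<psi> (\<iota> v)) + mero_const (\<xi> (\<iota> v))) (place \<psi> \<xi> r) = 0"
proof -
  note lin = hom[THEN unital_algebra_homD(1)]
  have "commutator (mero_const (\<iota> v \<otimes> 1 + 1 \<otimes> \<iota> v)) r = 0"
    using invariant by (simp add: invariant_under_def)
  from arg_cong[OF this, of "place \<psi> \<xi>"] show ?thesis
    by (simp add: commutator_hom[OF unital_algebra_hom_pair[OF hom com]] clinear_0[OF clinear_place[OF lin]]
        pointwise_const clinear_pair lin clinear_add[OF clinear_pair[OF lin]] pair_pure hom[THEN unital_algebra_homD(3)])
      (simp add: mero_const_def tensor_add_right)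
qed

lemma E_commutator:
  "E \<phi> F - E' \<phi> F = (\<Sum>k=1..d. commutator (mero_const (\<phi> (\<iota> (x k)))) (mero_partial (lam k) F))"
  by (simp add: mero_E_def mero_E_right_def commutator_def sum_subtractf)

text \<open>The invariance condition has constant coefficients, so it passes to every derivative of
  r. Taking x_k with the derivative along \<lambda>_k and summing gives the claim, by
  \<open>E_commutator\<close>.\<close>

lemma E_place_r:
  assumes hom: "unital_algebra_hom \<psi>" "unital_algebra_hom \<xi>" and com: "commuting \<psi> \<xi>"
  shows "(E \<psi> (place \<psi> \<xi> r) - E' \<psi> (place \<psi> \<xi> r)) + (E \<xi> (place \<psi> \<xi> r) - E' \<xi> (place \<psi> \<xi> r)) = 0"
proof -
  have "commutator (mero_const (\<psi> (\<iota> v)) + mero_const (\<xi> (\<iota> v))) (mero_partial l (place \<psi> \<xi> r)) = 0" for v l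
    using arg_cong[OF commutator_place_r[OF assms, of v], of "mero_partial l"]
    by (simp add: commutator_def distrib_left distrib_right clinear_add[OF clinear_partial]
        clinear_diff[OF clinear_partial] clinear_0[OF clinear_partial] partial_const_mult)
  then show ?thesis
    by (simp add: E_commutator commutator_bilinear flip: sum.distrib)
qed

text \<open>\<open>E_place_r\<close> twisted by \<theta> in the first slot: r becomes s and the
  \<psi> part changes sign.\<close>

lemma E_place_s:
  assumes hom: "unital_algebra_hom \<psi>" "unital_algebra_hom \<xi>" and com: "commuting \<psi> \<xi>"
  shows "(E \<xi> (place \<psi> \<xi> s) - E' \<xi> (place \<psi> \<xi> s)) - (E \<psi> (place \<psi> \<xi> s) - E' \<psi> (place \<psi> \<xi> s)) = 0"
proof -
  note lin = hom[THEN unital_algebra_homD(1)]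
  have "E' (\<lambda>u. \<psi> (\<theta> u)) F = - E' \<psi> F" for F
    by (simp add: mero_E_right_def anti_invariant clinear_minus[OF lin(1)] mero_const_def
        clinear_minus[OF clinear_tensor_right] sum_negf)
  then show ?thesis
    using E_place_r[OF unital_algebra_hom_compose[OF hom(1) hom_theta] hom(2) commuting_compose(1)[OF com]]
    by (simp add: place_theta_r lin E_theta[OF hom(1)] algebra_simps)
qed

lemma place_diagonal:
  assumes "unital_algebra_hom \<psi>"
  shows "place \<psi> \<psi> s = pointwise \<psi> (kappa_core \<theta> r) + pointwise \<psi> (kappa_core \<theta> r)"
proof -
  note lin = unital_algebra_homD(1)[OF assms]
  have "place \<psi> \<psi> t = pointwise \<psi> (pointwise (tensor_lift (*)) t)" for t :: "'a dual mero \<otimes> ('u \<otimes> 'u)"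
    by (induction t rule: tensor_induct2)
      (simp_all add: pair_pure lin pointwise_pure clinear_tensor_lift cbilinear_times tensor_lift_pure
        unital_algebra_homD(2)[OF assms] clinear_add[OF clinear_pointwise] clinear_pair)
  then show ?thesis
    by (simp add: kappa_core_def flip: clinear_add[OF clinear_pointwise[OF lin]] scaleC_add_left)
qed

lemma core_reflection_equation:
  assumes hom: "unital_algebra_hom \<psi>" "unital_algebra_hom \<xi>" and com: "commuting \<psi> \<xi>"
  shows "commutator (pointwise \<psi> (kappa_core \<theta> r) + place \<psi> \<xi> (r_minus \<theta> r))
        (pointwise \<xi> (kappa_core \<theta> r) + place \<psi> \<xi> (r_plus \<theta> r))
      + E \<xi> (place \<psi> \<xi> (r_minus \<theta> r) + pointwise \<psi> (kappa_core \<theta> r))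
      - E \<psi> (place \<psi> \<xi> (r_plus \<theta> r) + pointwise \<xi> (kappa_core \<theta> r)) = 0"
    (is "?X = 0")
proof -
  note lin = hom[THEN unital_algebra_homD(1)]
  note subst = place_diagonal[OF hom(1)] place_diagonal[OF hom(2)] place_plus_minus[OF lin]
    commutator_bilinear E_arith
  have kappa: "pointwise \<psi> (kappa_core \<theta> r) * pointwise \<xi> (kappa_core \<theta> r)
      = pointwise \<xi> (kappa_core \<theta> r) * pointwise \<psi> (kappa_core \<theta> r)"
    using pointwise_commute[OF lin com] by (simp add: commutator_def)
  \<comment> \<open>The two contracted equations give half of each E term on r^+ or r^- in the form
    \<open>E'\<close>. \<open>E_place_s\<close> minus \<open>E_place_r\<close> converts that half to
    \<open>E\<close>. The two copies of [s, r] add up to 4 [r^-, r^+], and \<kappa>_1, \<kappa>_2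
    commute.\<close>
  have "(?X + ?X) + (?X + ?X) = 0"
    using add_eq_0[OF
        add_eq_0[OF contract_YB_plus[OF assms, unfolded subst] contract_YB_minus[OF assms, unfolded subst]]
        add_eq_0[OF E_place_s[OF assms, unfolded subst]
          E_place_r[OF assms, unfolded subst, THEN arg_cong[of _ _ uminus], unfolded minus_zero]]]
    by (simp add: commutator_def E_arith kappa algebra_simps)
  then show ?thesis by (blast dest: double_eq_0D)
qed

end

section \<open>The three k-matrices\<close>

definition cr_pos0 ::
    "'l::complex_algebra_1 \<Rightarrow> 'l \<otimes> 'u::complex_algebra_1 \<otimes> 'u \<otimes> 'r::complex_algebra_1"
  where "cr_pos0 a = a \<otimes> 1 \<otimes> 1 \<otimes> 1"

definition cr_pos0' ::
    "'r::complex_algebra_1 \<Rightarrow> 'l::complex_algebra_1 \<otimes> 'u::complex_algebra_1 \<otimes> 'u \<otimes> 'r"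
  where "cr_pos0' b = 1 \<otimes> 1 \<otimes> 1 \<otimes> b"

lemmas cr_pos_defs = cr_pos0_def cr_pos1_def cr_pos2_def cr_pos0'_def

lemma clinear_cr_pos: "clinear cr_pos0" "clinear cr_pos1" "clinear cr_pos2" "clinear cr_pos0'"
  by (simp_all add: clinear_iff cr_pos_defs tensor_bilinear_simps)

lemma unital_algebra_hom_cr_pos:
  "unital_algebra_hom cr_pos0" "unital_algebra_hom cr_pos1"
  "unital_algebra_hom cr_pos2" "unital_algebra_hom cr_pos0'"
  by (simp_all add: unital_algebra_hom_def clinear_cr_pos)
    (simp_all add: cr_pos_defs tensor_times_pure one_tensor_def)

lemma commuting_cr_pos:
  "commuting cr_pos0 cr_pos1" "commuting cr_pos0 cr_pos2" "commuting cr_pos0 cr_pos0'"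
  "commuting cr_pos1 cr_pos2" "commuting cr_pos0' cr_pos1" "commuting cr_pos0' cr_pos2"
  by (simp_all add: commuting_def cr_pos_defs tensor_times_pure)

lemma clinear_cr_kappa: "clinear cr_kappa1" "clinear cr_kappa2"
  unfolding cr_kappa1_def cr_kappa2_def
  by (intro clinear_tensor_map clinear_id clinear_tensor_right)+

lemma clinear_cr_pos12: "clinear cr_pos12"
  unfolding cr_pos12_def
  by (intro clinear_compose[OF clinear_tensor_right] clinear_tensor_map clinear_id clinear_tensor_left)

lemma clinear_k_pos: "clinear k_pos1" "clinear k_pos01" "clinear k_pos0'1"
proof -
  show "clinear k_pos1"
    by (simp add: clinear_iff k_pos1_def tensor_bilinear_simps)
  show "clinear k_pos01"
    unfolding k_pos01_def by (intro clinear_tensor_map clinear_id clinear_tensor_left)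
  show "clinear k_pos0'1"
    by (simp add: clinear_iff k_pos0'1_def tensor_bilinear_simps clinear_add[OF clinear_tensor_flip]
        clinear_scaleC[OF clinear_tensor_flip])
qed

lemma cr_pos_times:
  "cr_pos1 u * cr_pos2 v = 1 \<otimes> u \<otimes> v \<otimes> 1"
  "cr_pos0 a * cr_pos1 u = a \<otimes> u \<otimes> 1 \<otimes> 1" "cr_pos0 a * cr_pos2 u = a \<otimes> 1 \<otimes> u \<otimes> 1"
  "cr_pos0' b * cr_pos1 u = 1 \<otimes> u \<otimes> 1 \<otimes> b" "cr_pos0' b * cr_pos2 u = 1 \<otimes> 1 \<otimes> u \<otimes> b"
  by (simp_all add: cr_pos_defs tensor_times_pure)

text \<open>With the next two lemmas, this brings all terms of \<open>CR\<close> to the form covered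
  by \<open>mixed_YB\<close> and \<open>core_reflection_equation\<close>.\<close>

lemma cr_pos12_place: "pointwise cr_pos12 t = place cr_pos1 cr_pos2 t"
  by (induction t rule: tensor_induct2)
    (simp_all add: pointwise_pure clinear_cr_pos12 cr_pos_pure pair_pure clinear_pair clinear_cr_pos
      cr_pos_times clinear_add[OF clinear_pointwise])

lemma cr_kappa_k_pos1:
  "pointwise cr_kappa1 (pointwise k_pos1 t) = pointwise cr_pos1 t"
  "pointwise cr_kappa2 (pointwise k_pos1 t) = pointwise cr_pos2 t"
  by (simp_all add: pointwise_pointwise clinear_cr_kappa clinear_k_pos k_pos1_def cr_pos_pure
      flip: cr_pos1_def cr_pos2_def)

lemma cr_kappa_k_pos_pair:
  "pointwise cr_kappa1 (pointwise k_pos01 t) = place cr_pos0 cr_pos1 t"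
  "pointwise cr_kappa2 (pointwise k_pos01 t) = place cr_pos0 cr_pos2 t"
  "pointwise cr_kappa1 (pointwise k_pos0'1 t) = place cr_pos0' cr_pos1 t"
  "pointwise cr_kappa2 (pointwise k_pos0'1 t) = place cr_pos0' cr_pos2 t"
  by (induction t rule: tensor_induct2;
      simp add: pointwise_pure clinear_cr_kappa clinear_k_pos k_pos_pure cr_pos_pure clinear_pair
        pair_pure clinear_cr_pos cr_pos_times clinear_add[OF clinear_pointwise])+

section \<open>Values in U^+ \<otimes> U \<otimes> U^+\<close>

lemma tensor_subspace_pure: "a \<in> A \<Longrightarrow> b \<in> B \<Longrightarrow> a \<otimes> b \<in> tensor_subspace A B"
  unfolding tensor_subspace_def by (rule cv.span_base) auto

lemma tensor_subspace_mem:
  assumes t: "t \<in> tensor_subspace A B" and f: "clinear f"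
    and pure: "\<And>a b. a \<in> A \<Longrightarrow> b \<in> B \<Longrightarrow> f (a \<otimes> b) \<in> tensor_subspace C D"
  shows "f t \<in> tensor_subspace C D"
  using t unfolding tensor_subspace_def
proof (induction rule: cv.span_induct_alt)
  case base
  show ?case by (simp add: clinear_0[OF f] cv.span_zero)
next
  case (step c y z)
  then have "f y \<in> tensor_subspace C D" using pure by blast
  with step.IH show ?case
    by (simp add: tensor_subspace_def clinear_add[OF f] clinear_scaleC[OF f] cv.span_add cv.span_scale)
qed

lemma pointwise_tensor_subspace:
  assumes "clinear f" "\<And>b. b \<in> B \<Longrightarrow> f b \<in> C" "t \<in> tensor_subspace UNIV B"
  shows "pointwise f t \<in> tensor_subspace UNIV C"
  by (rule tensor_subspace_mem[OF assms(3) clinear_pointwise[OF assms(1)]])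
    (simp add: pointwise_pure assms tensor_subspace_pure)

lemma k_pos_mem:
  assumes "1 \<in> A"
  shows "k_pos1 u \<in> tensor_subspace A (tensor_subspace UNIV A)"
    and "t \<in> tensor_subspace A UNIV \<Longrightarrow> k_pos01 t \<in> tensor_subspace A (tensor_subspace UNIV A)"
    and "t \<in> tensor_subspace A UNIV \<Longrightarrow> k_pos0'1 t \<in> tensor_subspace A (tensor_subspace UNIV A)"
proof -
  show "k_pos1 u \<in> tensor_subspace A (tensor_subspace UNIV A)"
    unfolding k_pos1_def by (intro tensor_subspace_pure assms UNIV_I)
  have mem: "k_pos01 (a \<otimes> b) \<in> tensor_subspace A (tensor_subspace UNIV A)"
      "k_pos0'1 (a \<otimes> b) \<in> tensor_subspace A (tensor_subspace UNIV A)" if "a \<in> A" for a b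
    unfolding k_pos_pure using that by (intro tensor_subspace_pure assms UNIV_I; assumption)+
  assume t: "t \<in> tensor_subspace A UNIV"
  show "k_pos01 t \<in> tensor_subspace A (tensor_subspace UNIV A)"
    by (rule tensor_subspace_mem[OF t clinear_k_pos(2) mem(1)])
  show "k_pos0'1 t \<in> tensor_subspace A (tensor_subspace UNIV A)"
    by (rule tensor_subspace_mem[OF t clinear_k_pos(3) mem(2)])
qed

section \<open>Assembling the three k-matrices\<close>

context twisted_r_matrix
begin

text \<open>\<open>CR\<close> is quadratic in \<kappa>. Expanding at core + \<open>\<alpha>\<close>,
  the first two assumptions remove the commutators between core and \<open>\<alpha>\<close>; what
  remains is the equation for the core plus the third assumption.\<close>

lemma CR_core_plus:
  assumes "commutator (pointwise cr_pos1 (kappa_core \<theta> r)) (pointwise cr_kappa2 \<alpha>) = 0"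
    and "commutator (pointwise cr_kappa1 \<alpha>) (pointwise cr_pos2 (kappa_core \<theta> r)) = 0"
    and "commutator (pointwise cr_kappa1 \<alpha>) (pointwise cr_kappa2 \<alpha>)
      + commutator (pointwise cr_kappa1 \<alpha>) (place cr_pos1 cr_pos2 (r_plus \<theta> r))
      + commutator (place cr_pos1 cr_pos2 (r_minus \<theta> r)) (pointwise cr_kappa2 \<alpha>)
      + E cr_pos2 (pointwise cr_kappa1 \<alpha>) - E cr_pos1 (pointwise cr_kappa2 \<alpha>) = 0"
  shows "CR \<iota> d x lam (r_plus \<theta> r) (r_minus \<theta> r) (pointwise k_pos1 (kappa_core \<theta> r) + \<alpha>) = 0"
proof -
  have "CR \<iota> d x lam (r_plus \<theta> r) (r_minus \<theta> r) (pointwise k_pos1 (kappa_core \<theta> r) + \<alpha>)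
    = (commutator (pointwise cr_pos1 (kappa_core \<theta> r) + place cr_pos1 cr_pos2 (r_minus \<theta> r))
          (pointwise cr_pos2 (kappa_core \<theta> r) + place cr_pos1 cr_pos2 (r_plus \<theta> r))
        + E cr_pos2 (place cr_pos1 cr_pos2 (r_minus \<theta> r) + pointwise cr_pos1 (kappa_core \<theta> r))
        - E cr_pos1 (place cr_pos1 cr_pos2 (r_plus \<theta> r) + pointwise cr_pos2 (kappa_core \<theta> r)))
      + (commutator (pointwise cr_kappa1 \<alpha>) (pointwise cr_kappa2 \<alpha>)
        + commutator (pointwise cr_kappa1 \<alpha>) (place cr_pos1 cr_pos2 (r_plus \<theta> r))
        + commutator (place cr_pos1 cr_pos2 (r_minus \<theta> r)) (pointwise cr_kappa2 \<alpha>)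
        + E cr_pos2 (pointwise cr_kappa1 \<alpha>) - E cr_pos1 (pointwise cr_kappa2 \<alpha>))"
    by (simp add: CR_def Let_def cr_pos12_place cr_kappa_k_pos1 E_arith commutator_bilinear assms(1,2)
        clinear_add[OF clinear_pointwise[OF clinear_cr_kappa(1)]]
        clinear_add[OF clinear_pointwise[OF clinear_cr_kappa(2)]] algebra_simps)
  then show ?thesis
    by (simp only: assms(3) core_reflection_equation[OF unital_algebra_hom_cr_pos(2,3) commuting_cr_pos(4)])
      simp
qed

lemma CR_k_matrix:
  shows "CR \<iota> d x lam (r_plus \<theta> r) (r_minus \<theta> r)
      (pointwise k_pos1 (kappa_core \<theta> r) + pointwise k_pos01 (r_plus \<theta> r)) = 0"
    and "CR \<iota> d x lam (r_plus \<theta> r) (r_minus \<theta> r)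
      (pointwise k_pos1 (kappa_core \<theta> r) + pointwise k_pos0'1 (r_plus \<theta> r)) = 0"
    and "CR \<iota> d x lam (r_plus \<theta> r) (r_minus \<theta> r)
      (pointwise k_pos1 (kappa_core \<theta> r) + (pointwise k_pos01 (r_plus \<theta> r) + pointwise k_pos0'1 (r_plus \<theta> r))) = 0"
proof -
  note lin = clinear_cr_pos and com = commuting_cr_pos
  note pl = cr_kappa_k_pos_pair
  have core: "commutator (pointwise cr_pos1 (kappa_core \<theta> r)) (place cr_pos0 cr_pos2 t) = 0"
    "commutator (pointwise cr_pos1 (kappa_core \<theta> r)) (place cr_pos0' cr_pos2 t) = 0"
    "commutator (place cr_pos0 cr_pos1 t) (pointwise cr_pos2 (kappa_core \<theta> r)) = 0"
    "commutator (place cr_pos0' cr_pos1 t) (pointwise cr_pos2 (kappa_core \<theta> r)) = 0" for t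
    by (intro pointwise_commute clinear_pair lin commuting_pair com com[THEN commuting_sym]
        commuting_sym[OF commuting_pair])+
  \<comment> \<open>The positions 0, 1 and 0', 2 are disjoint, so the two boundary terms do not
    interact and the third k-matrix follows by adding the equations of the first two.\<close>
  have ends_commuting: "commuting (pair cr_pos0 cr_pos1) (pair cr_pos0' cr_pos2)"
    "commuting (pair cr_pos0' cr_pos1) (pair cr_pos0 cr_pos2)"
    by (intro commuting_pair lin commuting_sym[OF commuting_pair] com com[THEN commuting_sym])+
  have ends: "commutator (place cr_pos0 cr_pos1 t) (place cr_pos0' cr_pos2 t') = 0"
    "commutator (place cr_pos0' cr_pos1 t) (place cr_pos0 cr_pos2 t') = 0" for t t'
    by (simp_all add: pointwise_commute clinear_pair lin ends_commuting)
  note left = mixed_YB[OF unital_algebra_hom_cr_pos(1-3) com(1,2,4)]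
    and right = mixed_YB[OF unital_algebra_hom_cr_pos(4,2,3) com(5,6,4)]
  show "CR \<iota> d x lam (r_plus \<theta> r) (r_minus \<theta> r)
      (pointwise k_pos1 (kappa_core \<theta> r) + pointwise k_pos01 (r_plus \<theta> r)) = 0"
    by (rule CR_core_plus; unfold pl) (rule core left)+
  show "CR \<iota> d x lam (r_plus \<theta> r) (r_minus \<theta> r)
      (pointwise k_pos1 (kappa_core \<theta> r) + pointwise k_pos0'1 (r_plus \<theta> r)) = 0"
    by (rule CR_core_plus; unfold pl) (rule core right)+
  show "CR \<iota> d x lam (r_plus \<theta> r) (r_minus \<theta> r)
      (pointwise k_pos1 (kappa_core \<theta> r) + (pointwise k_pos01 (r_plus \<theta> r) + pointwise k_pos0'1 (r_plus \<theta> r))) = 0"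
    using add_eq_0[OF left right]
    by (intro CR_core_plus)
      (simp_all add: clinear_add[OF clinear_pointwise[OF clinear_cr_kappa(1)]]
        clinear_add[OF clinear_pointwise[OF clinear_cr_kappa(2)]] pl commutator_bilinear core ends
        E_arith algebra_simps)
qed

lemma k_matrix_mem:
  "pointwise k_pos1 (kappa_core \<theta> r)
    \<in> tensor_subspace UNIV (tensor_subspace (eigenspace \<theta> 1) (tensor_subspace UNIV (eigenspace \<theta> 1)))"
  "pointwise k_pos01 (r_plus \<theta> r)
    \<in> tensor_subspace UNIV (tensor_subspace (eigenspace \<theta> 1) (tensor_subspace UNIV (eigenspace \<theta> 1)))"
  "pointwise k_pos0'1 (r_plus \<theta> r)
    \<in> tensor_subspace UNIV (tensor_subspace (eigenspace \<theta> 1) (tensor_subspace UNIV (eigenspace \<theta> 1)))"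
proof -
  have "1 \<in> eigenspace \<theta> 1"
    using unital_subalgebra_eigenspace[OF hom_theta] by (simp add: unital_subalgebra_def)
  note mem = k_pos_mem[OF this]
  have "t \<in> tensor_subspace UNIV UNIV" for t :: "'a dual mero \<otimes> 'u"
    by (induction t rule: tensor_induct)
      (auto simp: tensor_subspace_def intro: cv.span_base cv.span_add)
  then show "pointwise k_pos1 (kappa_core \<theta> r)
    \<in> tensor_subspace UNIV (tensor_subspace (eigenspace \<theta> 1) (tensor_subspace UNIV (eigenspace \<theta> 1)))"
    by (rule pointwise_tensor_subspace[OF clinear_k_pos(1) mem(1)])
qed (rule pointwise_tensor_subspace[OF _ k_pos_mem(2)] pointwise_tensor_subspace[OF _ k_pos_mem(3)]
    clinear_k_pos unital_subalgebra_eigenspace[OF hom_theta, unfolded unital_subalgebra_def, THEN conjunct2, THEN conjunct1]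
    r_plus_minus_values(1)[OF involutive] | assumption)+

end

theorem corollary5p8:
  fixes \<theta> :: "'u::complex_algebra_1 \<Rightarrow> 'u"
    and \<aa> :: "'u set"
    and \<iota> :: "'a::complex_vector \<Rightarrow> 'u"
    and d :: nat and x :: "nat \<Rightarrow> 'a" and lam :: "nat \<Rightarrow> 'a dual"
    and r :: "'a dual mero \<otimes> ('u \<otimes> 'u)"
  assumes "involutive_algebra_automorphism \<theta>"
    and "csubspace \<aa>" and "\<aa> \<subseteq> eigenspace \<theta> (-1)"
    and "clinear \<iota>" and "inj \<iota>" and "range \<iota> = \<aa>"
    and "dual_bases d x lam"
    and "theta_twisted_symmetric \<theta> r"
    and "invariant_under \<aa> r"
    and "classical_dynamical_r_matrix \<iota> d x lam r"
  shows "\<forall>\<kappa> \<in>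
      {pointwise k_pos1 (kappa_core \<theta> r) + pointwise k_pos01 (r_plus \<theta> r),
       pointwise k_pos1 (kappa_core \<theta> r) + pointwise k_pos0'1 (r_plus \<theta> r),
       pointwise k_pos1 (kappa_core \<theta> r) + pointwise k_pos01 (r_plus \<theta> r)
         + pointwise k_pos0'1 (r_plus \<theta> r)}.
    classical_dynamical_k_matrix \<iota> d x lam (eigenspace \<theta> 1) (eigenspace \<theta> 1)
      (r_plus \<theta> r) (r_minus \<theta> r) \<kappa>"
proof -
  have "\<theta> (\<iota> v) = - \<iota> v" for v
  proof -
    have "\<iota> v \<in> eigenspace \<theta> (-1)"
      using assms(3,6) by blast
    then show ?thesis by (simp add: eigenspace_def scaleC_one)
  qed
  then interpret twisted_r_matrix \<theta> \<iota> d x lam r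
    using assms by unfold_locales auto
  \<comment> \<open>Only the outer subspace is opened into a span, so that membership of the sums
    follows by additivity.\<close>
  note mem = k_matrix_mem[unfolded tensor_subspace_def[of UNIV "tensor_subspace _ _"]]
  show ?thesis
    using CR_k_matrix mem
    by (auto simp: classical_dynamical_k_matrix_def tensor_subspace_def[of UNIV "tensor_subspace _ _"]
        add.assoc intro!: cv.span_add)
qed

end
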